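(* Let $\mathcal A$ be a $\mathbb Z^n$-graded associative commutative algebra with unit $\mathbf 1$, let $\alpha\in\mathbb Z^n$, and let $S\in\mathcal D^\alpha_2(\mathcal A)$ be a supercanonical structure of degree $|S|=\alpha$. Then for any scalar parameter $t$ the operator on $\mathcal D^\alpha(\mathcal A)$ $$\partial^t_{LJ}(A)=[\![S,A]\!]+t\,S(\mathbf 1)\cdot A$$ has square $0$, i.e. it is a cohomology operator on $\mathcal D^\alpha(\mathcal A)$, of degree $(\alpha,1)$ (it raises the degree $|\cdot|$ by $\alpha$ and the genus $i$ by $1$).
   Context: Fix a ground field of characteristic $0$; $\langle\cdot,\cdot\rangle$ is the standard pairing on $\mathbb Z^n$. $\mathcal A$ is graded commutative: $ab=(-1)^{\langle |a|,|b|\rangle}ba$. All elements in formulas are homogeneous and in exponents a symbol denotes its degree. The graded $\mathcal A$-bimodules $\mathcal D^\alpha_i=\mathcal D^\alpha_i(\mathcal A)$ (of genus $i$) are defined by induction, with right module structure $p\cdot a=(-1)^{\langle a,p+i\alpha\rangle}a\cdot p$ for $p\in\mathcal D^\alpha_i$. $\mathcal D^\alpha_0=\mathcal A$. $\mathcal D^\alpha_1$ is the space of graded linear maps $D:\mathcal A\to\mathcal A$ ($|D(a)|=|D|+|a|$) with $D(ab)=D(a)b+(-1)^{\langle a,D\rangle}aD(b)-D(\mathbf 1)ab$. For $i>1$, $\mathcal D^\alpha_i$ consists of graded linear maps $D:\mathcal A\to\mathcal D^\alpha_{i-1}$ with $D(ab)=D(a)\cdot b+(-1)^{\langle a,D+(i-1)\alpha\rangle}a\cdot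 D(b)-D(\mathbf 1)\cdot ab$ and $D(a,b)=-(-1)^{\langle a+\alpha,b+\alpha\rangle}D(b,a)$, where $D(a_1,\dots,a_j)=D(a_1,\dots,a_{j-1})(a_j)$; left module structure $(a\cdot D)(b)=a\cdot D(b)$. $\mathcal D^\alpha(\mathcal A)=\bigoplus_i\mathcal D^\alpha_i$. Product on $\mathcal D^\alpha(\mathcal A)$, extending the bimodule structures over $\mathcal D^\alpha_0=\mathcal A$: $(A\cdot B)(a)=(-1)^{\langle a+\alpha,B+j\alpha\rangle+j}A(a)\cdot B+A\cdot B(a)$ for $A\in\mathcal D^\alpha_i$, $B\in\mathcal D^\alpha_j$, $a\in\mathcal A$ (with $A(a)=0$ for $A\in\mathcal D_0^\alpha$). It makes $\mathcal D^\alpha(\mathcal A)$ a $\mathbb Z^{n+1}$-graded associative commutative algebra with $A\in\mathcal D^\alpha_i$ of degree $(|A|+i\alpha,i)$. Schouten-Jacobi bracket on $\mathcal D^\alpha(\mathcal A)$ (a graded Jacobi bracket of degree $(-\alpha,-1)$): $[\![a,b]\!]=0$ for $a,b\in\mathcal A$; $[\![D,a]\!]=D(a)$ and $[\![a,D]\!]=(-1)^{\langle a-\alpha,D+(i-1)\alpha\rangle+i}D(a)$ for $a\in\mathcal A$, $D\in\mathcal D^\alpha_i$; and $[\![A,B]\!](a)=(-1)^{\langle a-\alpha,B+(j-1)\alpha\rangle+j-1}[\![A(a),B]\!]+[\![A,B(a)]\!]$ for $A\in\mathcal D^\alpha_i$, $B\in\mathcal D^\alpha_j$. A supercanonical structure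 is a homogeneous $S\in\mathcal D^\alpha_2(\mathcal A)$ such that $\langle |S|+\alpha,|S|+\alpha\rangle$ is even and $[\![S,S]\!]=0$. *)

theory Defs
  imports "HOL-Analysis.Finite_Cartesian_Product" "HOL-Library.Function_Algebras"
begin

text \<open>
  Addition, negation and zero on functions are the pointwise ones of
  \<^theory>\<open>HOL-Library.Function_Algebras\<close>; the pointwise multiplication
  of functions defined there is never used.
\<close>

definition pairing :: "int ^ 'n \<Rightarrow> int ^ 'n \<Rightarrow> int" where
  "pairing d e = (\<Sum>i\<in>UNIV. d $ i * e $ i)"

text \<open>Multiplication by \<open>(-1)\<^sup>k\<close> for \<open>k \<in> \<int>\<close>.\<close>

definition sign :: "int \<Rightarrow> 'v::ab_group_add \<Rightarrow> 'v" where
  "sign k x = (if even k then x else - x)"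

definition is_decomposition ::
    "('d \<Rightarrow> 'v::comm_monoid_add set) \<Rightarrow> 'v \<Rightarrow> ('d \<Rightarrow> 'v) \<Rightarrow> bool" where
  "is_decomposition V x f \<longleftrightarrow>
     finite {d. f d \<noteq> 0} \<and> (\<forall>d. f d \<in> V d) \<and> x = (\<Sum>d | f d \<noteq> 0. f d)"

text \<open>Only meaningful where the decomposition exists and is unique.\<close>

definition component :: "('d \<Rightarrow> 'v::comm_monoid_add set) \<Rightarrow> 'v \<Rightarrow> 'd \<Rightarrow> 'v" where
  "component V x = (THE f. is_decomposition V x f)"

definition direct_sum :: "('d \<Rightarrow> 'v::comm_monoid_add set) \<Rightarrow> 'v set" where
  "direct_sum V = {x. \<exists>f. is_decomposition V x f}"

definition cohomology_operator_on ::
    "'v::ab_group_add set \<Rightarrow> ('k \<Rightarrow> 'v \<Rightarrow> 'v) \<Rightarrow> ('v \<Rightarrow> 'v) \<Rightarrow> bool" where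
  "cohomology_operator_on V scl \<delta> \<longleftrightarrow>
     (\<forall>x\<in>V. \<delta> x \<in> V) \<and>
     (\<forall>x\<in>V. \<forall>y\<in>V. \<delta> (x + y) = \<delta> x + \<delta> y) \<and>
     (\<forall>c. \<forall>x\<in>V. \<delta> (scl c x) = scl c (\<delta> x)) \<and>
     (\<forall>x\<in>V. \<delta> (\<delta> x) = 0)"

locale graded_comm_algebra = vector_space scale
  for scale :: "'k::field_char_0 \<Rightarrow> 'a::{ring, monoid_mult} \<Rightarrow> 'a" (infixr \<open>*\<^sub>k\<close> 75) +
  fixes G :: "int ^ 'n \<Rightarrow> 'a set"
  assumes scale_mult_left: "(c *\<^sub>k a) * b = c *\<^sub>k (a * b)"
    and scale_mult_right: "a * (c *\<^sub>k b) = c *\<^sub>k (a * b)"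
    and subspace_G: "subspace (G d)"
    and decomposition: "\<exists>!f. is_decomposition G a f"
    and one_G: "1 \<in> G 0"
    and mult_G: "a \<in> G d \<Longrightarrow> b \<in> G e \<Longrightarrow> a * b \<in> G (d + e)"
    and graded_comm: "a \<in> G d \<Longrightarrow> b \<in> G e \<Longrightarrow> a * b = sign (pairing d e) (b * a)"

text \<open>
  An element \<open>D\<close> of genus \<open>i\<close> is stored uncurried, as the function
  \<open>[a\<^sub>1, \<dots>, a\<^sub>i] \<mapsto> D(a\<^sub>1, \<dots>, a\<^sub>i)\<close> extended by 0 to lists of any other
  length. Hence the direct sum over the genus is taken inside \<open>'a list \<Rightarrow> 'a\<close>,
  with an element of genus 0 supported on the empty list.
\<close>

definition of_alg :: "'a \<Rightarrow> ('a list \<Rightarrow> 'a::zero)" where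
  "of_alg a = (\<lambda>xs. if xs = [] then a else 0)"

definition app :: "('a list \<Rightarrow> 'a) \<Rightarrow> 'a \<Rightarrow> ('a list \<Rightarrow> 'a)" (infixl \<open>\<bullet>\<close> 100) where
  "D \<bullet> a = (\<lambda>xs. D (a # xs))"

definition lact :: "'a::times \<Rightarrow> ('a list \<Rightarrow> 'a) \<Rightarrow> ('a list \<Rightarrow> 'a)" where
  "lact a D = (\<lambda>xs. a * D xs)"

locale schouten_jacobi = graded_comm_algebra scale G
  for scale :: "'k::field_char_0 \<Rightarrow> 'a::{ring, monoid_mult} \<Rightarrow> 'a" (infixr \<open>*\<^sub>k\<close> 75)
    and G :: "int ^ 'n \<Rightarrow> 'a set" +
  fixes \<alpha> :: "int ^ 'n"
begin

definition scale_fun :: "'k \<Rightarrow> ('a list \<Rightarrow> 'a) \<Rightarrow> ('a list \<Rightarrow> 'a)" where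
  "scale_fun c D = (\<lambda>xs. c *\<^sub>k D xs)"

text \<open>Right action of \<open>a\<close> of degree \<open>e\<close> on \<open>D\<close> of genus \<open>i\<close> and degree \<open>d\<close>.\<close>

definition ract :: "nat \<Rightarrow> int ^ 'n \<Rightarrow> ('a list \<Rightarrow> 'a) \<Rightarrow> int ^ 'n \<Rightarrow> 'a \<Rightarrow> ('a list \<Rightarrow> 'a)" where
  "ract i d D e a = sign (pairing e (d + int i *s \<alpha>)) (lact a D)"

text \<open>
  \<open>DO i d\<close> is the space of homogeneous elements of genus \<open>i\<close> and degree \<open>d\<close>.
  In the second equation \<open>D\<close> has genus \<open>i + 1\<close> and its values have genus \<open>i\<close>.
\<close>

fun DO :: "nat \<Rightarrow> int ^ 'n \<Rightarrow> ('a list \<Rightarrow> 'a) set" where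
  "DO 0 d = of_alg ` G d"
| "DO (Suc i) d = {D.
     D [] = 0 \<and>
     Vector_Spaces.linear scale scale_fun (app D) \<and>
     (\<forall>e. \<forall>a\<in>G e. D \<bullet> a \<in> DO i (d + e)) \<and>
     (\<forall>e f. \<forall>a\<in>G e. \<forall>b\<in>G f.
        D \<bullet> (a * b) =
          ract i (d + e) (D \<bullet> a) f b
          + sign (pairing e (d + int i *s \<alpha>)) (lact a (D \<bullet> b))
          - ract i d (D \<bullet> 1) (e + f) (a * b)) \<and>
     (i > 0 \<longrightarrow> (\<forall>e f. \<forall>a\<in>G e. \<forall>b\<in>G f.
        D \<bullet> a \<bullet> b = - sign (pairing (e + \<alpha>) (f + \<alpha>)) (D \<bullet> b \<bullet> a)))}"

definition DO_family :: "nat \<times> (int ^ 'n) \<Rightarrow> ('a list \<Rightarrow> 'a) set" where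
  "DO_family = (\<lambda>(i, d). DO i d)"

definition DO_all :: "('a list \<Rightarrow> 'a) set" where
  "DO_all = direct_sum DO_family"

text \<open>
  The linear map \<open>D\<close> with \<open>D \<bullet> a = \<phi> e a\<close> for \<open>a\<close> homogeneous of degree \<open>e\<close>.
\<close>

definition lin_ext :: "(int ^ 'n \<Rightarrow> 'a \<Rightarrow> ('a list \<Rightarrow> 'a)) \<Rightarrow> ('a list \<Rightarrow> 'a)" where
  "lin_ext \<phi> = (\<lambda>xs. case xs of [] \<Rightarrow> 0
     | a # ys \<Rightarrow> (\<Sum>e | component G a e \<noteq> 0. \<phi> e (component G a e) ys))"

text \<open>Bilinear extension to \<open>DO_all\<close> of an operation given on homogeneous elements.\<close>

definition bilin_ext ::
    "(nat \<Rightarrow> int ^ 'n \<Rightarrow> nat \<Rightarrow> int ^ 'n \<Rightarrow> ('a list \<Rightarrow> 'a) \<Rightarrow> ('a list \<Rightarrow> 'a) \<Rightarrow> ('a list \<Rightarrow> 'a)) \<Rightarrow>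
     ('a list \<Rightarrow> 'a) \<Rightarrow> ('a list \<Rightarrow> 'a) \<Rightarrow> ('a list \<Rightarrow> 'a)" where
  "bilin_ext \<mu> A B =
     (\<Sum>(i, p) | component DO_family A (i, p) \<noteq> 0.
      \<Sum>(j, q) | component DO_family B (j, q) \<noteq> 0.
        \<mu> i p j q (component DO_family A (i, p)) (component DO_family B (j, q)))"

text \<open>
  \<open>prod_hom i p j q A B\<close> and \<open>bracket_hom i p j q A B\<close> are the product and the
  bracket of \<open>A\<close> of genus \<open>i\<close>, degree \<open>p\<close> with \<open>B\<close> of genus \<open>j\<close>, degree \<open>q\<close>.
\<close>

fun prod_hom ::
    "nat \<Rightarrow> int ^ 'n \<Rightarrow> nat \<Rightarrow> int ^ 'n \<Rightarrow> ('a list \<Rightarrow> 'a) \<Rightarrow> ('a list \<Rightarrow> 'a) \<Rightarrow> ('a list \<Rightarrow> 'a)" where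
  "prod_hom 0 p j q A B = lact (A []) B"
| "prod_hom (Suc i) p 0 q A B = ract (Suc i) p A q (B [])"
| "prod_hom (Suc i) p (Suc j) q A B = lin_ext (\<lambda>e a.
     sign (pairing (e + \<alpha>) (q + int (Suc j) *s \<alpha>) + int (Suc j))
       (prod_hom i (p + e) (Suc j) q (A \<bullet> a) B)
     + prod_hom (Suc i) p j (q + e) A (B \<bullet> a))"

fun bracket_hom ::
    "nat \<Rightarrow> int ^ 'n \<Rightarrow> nat \<Rightarrow> int ^ 'n \<Rightarrow> ('a list \<Rightarrow> 'a) \<Rightarrow> ('a list \<Rightarrow> 'a) \<Rightarrow> ('a list \<Rightarrow> 'a)" where
  "bracket_hom 0 p 0 q A B = 0"
| "bracket_hom (Suc i) p 0 q A B = A \<bullet> (B [])"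
| "bracket_hom 0 p (Suc j) q A B =
     sign (pairing (p - \<alpha>) (q + int j *s \<alpha>) + int (Suc j)) (B \<bullet> (A []))"
| "bracket_hom (Suc i) p (Suc j) q A B = lin_ext (\<lambda>e a.
     sign (pairing (e - \<alpha>) (q + int j *s \<alpha>) + int j)
       (bracket_hom i (p + e) (Suc j) q (A \<bullet> a) B)
     + bracket_hom (Suc i) p j (q + e) A (B \<bullet> a))"

definition sj_product :: "('a list \<Rightarrow> 'a) \<Rightarrow> ('a list \<Rightarrow> 'a) \<Rightarrow> ('a list \<Rightarrow> 'a)" where
  "sj_product = bilin_ext prod_hom"

definition sj_bracket :: "('a list \<Rightarrow> 'a) \<Rightarrow> ('a list \<Rightarrow> 'a) \<Rightarrow> ('a list \<Rightarrow> 'a)" where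
  "sj_bracket = bilin_ext bracket_hom"

definition supercanonical :: "int ^ 'n \<Rightarrow> ('a list \<Rightarrow> 'a) \<Rightarrow> bool" where
  "supercanonical d S \<longleftrightarrow>
     S \<in> DO 2 d \<and> even (pairing (d + \<alpha>) (d + \<alpha>)) \<and> sj_bracket S S = 0"

definition LJ_operator :: "'k \<Rightarrow> ('a list \<Rightarrow> 'a) \<Rightarrow> ('a list \<Rightarrow> 'a) \<Rightarrow> ('a list \<Rightarrow> 'a)" where
  "LJ_operator t S A = sj_bracket S A + scale_fun t (sj_product (S \<bullet> 1) A)"

end

end

theory Submission
  imports Defs
begin

text \<open>
  Everything rests on one observation: evaluation \<open>D \<mapsto> D(a)\<close> is the right
  operator \<open>[[\<cdot>, a]]\<close>, it acts as a graded derivation on the product and on the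
  bracket, and an element of positive genus is determined by its evaluations at
  homogeneous \<open>a\<close>. Hence the Leibniz rule
  \<open>[[A, BC]] = [[A, B]]C \<plusminus> B[[A, C]] - A(1)BC\<close>, the Jacobi identity and graded
  commutativity follow by induction on the total genus; only the cases with an
  argument in \<open>\<A>\<close> need a direct argument. The rule for \<open>[[A, yB]]\<close> with
  \<open>y \<in> \<A>\<close> comes first, because it is what shows that the bracket of two
  operators is again a first order operator.

  Since \<open>S\<close> is odd for the bracket, the Jacobi identity turns \<open>[[S, S]] = 0\<close> into
  \<open>[[S, [[S, A]]]] = 0\<close>. In particular \<open>T = S(1) = [[S, 1]]\<close> satisfies
  \<open>[[S, T]] = 0\<close>; it is odd for the product, so \<open>T(TA) = 0\<close>, and the Leibniz rule gives
  \<open>[[S, TA]] = - T[[S, A]]\<close>. These identities cancel all terms of \<open>\<partial>\<^sup>2\<close>.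
\<close>

section \<open>Unique decompositions\<close>

text \<open>All signs come from one symmetric bilinear form. An operator of genus i and degree d has
  product bidegree (d + i \<alpha>, i) and bracket bidegree smaller by \<omega> = (\<alpha>, 1).
  Signs are scalars, multiplicative in each bidegree and of square 1, so that an identity becomes an
  equality of linear combinations which sorting and cancelling can decide. The obstacle is a
  circularity: comparing operators through their evaluations presupposes that both sides are linear,
  yet the bracket is known to be an operator only after a Leibniz rule has been proved. Linearity in
  the first argument alone, which is available directly from the recursion, is enough for that
  comparison and breaks the circle. Evaluations of an algebra element vanish, so the induction can
  only treat identities whose two sides have genus at least 1; this decides which base cases occur.
  For |S| = \<alpha> the bracket bidegree of S is (2 \<alpha>, 1), and its pairing with itself is 4
  times that of \<alpha> plus 1, hence odd. The same pair is the product bidegree of S(1), which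
  explains both oddness claims.\<close>

locale independent_family =
  fixes V :: "'d \<Rightarrow> 'v::ab_group_add set"
  assumes zero_mem: "0 \<in> V d"
    and add_mem: "x \<in> V d \<Longrightarrow> y \<in> V d \<Longrightarrow> x + y \<in> V d"
    and minus_mem: "x \<in> V d \<Longrightarrow> - x \<in> V d"
    and independent: "is_decomposition V 0 f \<Longrightarrow> f d = 0"
begin

text \<open>The index set \<open>F\<close> may be larger than the support, so that several families
  can be summed over one common set.\<close>

lemma is_decompositionI:
  assumes "finite F" "\<And>d. d \<notin> F \<Longrightarrow> f d = 0" "\<And>d. f d \<in> V d" "x = sum f F"
  shows "is_decomposition V x f"
proof -
  have "{d. f d \<noteq> 0} \<subseteq> F" using assms(2) by auto
  then have "sum f F = sum f {d. f d \<noteq> 0}"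
    using assms(1) by (intro sum.mono_neutral_right) auto
  then show ?thesis
    unfolding is_decomposition_def
    using assms finite_subset[OF \<open>_ \<subseteq> F\<close> assms(1)] by auto
qed

lemma is_decomposition_sum:
  assumes "is_decomposition V x f" "finite F" "\<And>d. d \<notin> F \<Longrightarrow> f d = 0"
  shows "x = sum f F"
proof -
  have "{d. f d \<noteq> 0} \<subseteq> F" using assms(3) by auto
  then have "sum f F = sum f {d. f d \<noteq> 0}"
    using assms(2) by (intro sum.mono_neutral_right) auto
  then show ?thesis using assms(1) unfolding is_decomposition_def by simp
qed

lemma is_decomposition_map:
  assumes "is_decomposition V x f" "additive h" "\<And>d y. y \<in> V d \<Longrightarrow> h y \<in> V d"
  shows "is_decomposition V (h x) (\<lambda>d. h (f d))"
proof (rule is_decompositionI[where F = "{d. f d \<noteq> 0}"])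
  show "h x = (\<Sum>d | f d \<noteq> 0. h (f d))"
    using assms(1) additive.sum[OF assms(2)] unfolding is_decomposition_def by simp
qed (use assms additive.zero[OF assms(2)] in \<open>auto simp: is_decomposition_def\<close>)

lemma is_decomposition_add:
  assumes "is_decomposition V x f" "is_decomposition V y g"
  shows "is_decomposition V (x + y) (\<lambda>d. f d + g d)"
proof (rule is_decompositionI[where F = "{d. f d \<noteq> 0} \<union> {d. g d \<noteq> 0}"])
  let ?F = "{d. f d \<noteq> 0} \<union> {d. g d \<noteq> 0}"
  show fin: "finite ?F"
    using assms unfolding is_decomposition_def by simp
  have "x = sum f ?F" "y = sum g ?F"
    using is_decomposition_sum[OF assms(1) fin] is_decomposition_sum[OF assms(2) fin] by auto
  then show "x + y = (\<Sum>d\<in>?F. f d + g d)"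
    by (simp only: sum.distrib)
qed (use assms add_mem in \<open>auto simp: is_decomposition_def\<close>)

lemma is_decomposition_unique:
  assumes "is_decomposition V x f" "is_decomposition V x g"
  shows "f = g"
proof
  fix d
  have "is_decomposition V (- x) (\<lambda>d. - g d)"
    using assms(2) by (rule is_decomposition_map) (auto simp: minus_mem additive_def)
  from is_decomposition_add[OF assms(1) this] have "is_decomposition V 0 (\<lambda>d. f d + - g d)"
    by simp
  from independent[OF this, of d] show "f d = g d" by simp
qed

lemma component_eq:
  assumes "is_decomposition V x f"
  shows "component V x = f"
  unfolding component_def using assms is_decomposition_unique by blast

lemma is_decomposition_component:
  assumes "x \<in> direct_sum V"
  shows "is_decomposition V x (component V x)"
  using assms component_eq unfolding direct_sum_def by auto

lemma finite_component: "x \<in> direct_sum V \<Longrightarrow> finite {d. component V x d \<noteq> 0}"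
  and component_mem: "x \<in> direct_sum V \<Longrightarrow> component V x d \<in> V d"
  and sum_component: "x \<in> direct_sum V \<Longrightarrow> (\<Sum>d | component V x d \<noteq> 0. component V x d) = x"
  using is_decomposition_component unfolding is_decomposition_def by auto

lemma is_decomposition_homogeneous:
  assumes "x \<in> V d"
  shows "is_decomposition V x (\<lambda>e. if e = d then x else 0)"
  by (rule is_decompositionI[where F = "{d}"]) (use assms zero_mem in auto)

lemma component_homogeneous: "x \<in> V d \<Longrightarrow> component V x = (\<lambda>e. if e = d then x else 0)"
  by (rule component_eq[OF is_decomposition_homogeneous])

lemma mem_direct_sum: "x \<in> V d \<Longrightarrow> x \<in> direct_sum V"
  using is_decomposition_homogeneous unfolding direct_sum_def by blast

lemma component_add:
  assumes "x \<in> direct_sum V" "y \<in> direct_sum V"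
  shows "component V (x + y) d = component V x d + component V y d"
  using component_eq[OF is_decomposition_add[OF assms[THEN is_decomposition_component]]] by simp

lemma direct_sum_add: "x \<in> direct_sum V \<Longrightarrow> y \<in> direct_sum V \<Longrightarrow> x + y \<in> direct_sum V"
  using is_decomposition_add unfolding direct_sum_def by blast

lemma component_map:
  assumes "x \<in> direct_sum V" "additive h" "\<And>d y. y \<in> V d \<Longrightarrow> h y \<in> V d"
  shows "component V (h x) d = h (component V x d)"
  using component_eq[OF is_decomposition_map[OF is_decomposition_component]] assms by metis

text \<open>Zero needs no case of its own because it lies in every \<open>V d\<close>. This is how
  additive identities are carried from homogeneous elements to the whole space.\<close>

lemma direct_sum_induct [consumes 1, case_names homogeneous add]:
  assumes "x \<in> direct_sum V"
    and "\<And>d x. x \<in> V d \<Longrightarrow> Q x"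
    and "\<And>x y. x \<in> direct_sum V \<Longrightarrow> y \<in> direct_sum V \<Longrightarrow> Q x \<Longrightarrow> Q y \<Longrightarrow> Q (x + y)"
  shows "Q x"
proof -
  define f where "f = component V x"
  have mem: "f d \<in> V d" for d
    using component_mem[OF assms(1)] by (simp add: f_def)
  have "sum f F \<in> direct_sum V \<and> Q (sum f F)" if "finite F" for F
    using that
  proof induction
    case empty
    then show ?case using zero_mem assms(2) mem_direct_sum by auto
  next
    case (insert d F)
    moreover have "f d \<in> direct_sum V" "Q (f d)"
      using mem_direct_sum[OF mem] assms(2)[OF mem] by auto
    ultimately show ?case using assms(3) direct_sum_add by simp
  qed
  from this[OF finite_component[OF assms(1)]] show ?thesis
    using sum_component[OF assms(1)] by (simp add: f_def)
qed

end

section \<open>Homogeneous components in the algebra\<close>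

context graded_comm_algebra
begin

text \<open>Unique decomposition is an axiom for the algebra, so comparing with the zero family
  gives independence. For the operator spaces the same property has to be proved.\<close>

sublocale grading: independent_family G
proof
  fix f d assume "is_decomposition G 0 f"
  moreover have "is_decomposition G 0 (\<lambda>d. 0)"
    using subspace_0[OF subspace_G] by (simp add: is_decomposition_def)
  ultimately have "f = (\<lambda>d. 0)" using decomposition by blast
  then show "f d = 0" by simp
qed (use subspace_G in \<open>auto intro: subspace_0 subspace_add subspace_neg\<close>)

lemma mem_direct_sum_G [simp]: "a \<in> direct_sum G"
  using decomposition unfolding direct_sum_def by blast

lemma component_G_add: "component G (a + b) e = component G a e + component G b e"
  by (simp add: grading.component_add)

lemma additive_scale: "additive (scale c)"
  by unfold_locales (simp add: scale_right_distrib)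

lemma component_G_scale: "component G (c *\<^sub>k a) e = c *\<^sub>k component G a e"
  by (rule grading.component_map[OF mem_direct_sum_G additive_scale subspace_scale[OF subspace_G]])

lemma component_G_mem [simp]: "component G a e \<in> G e"
  by (simp add: grading.component_mem)

end

section \<open>Multilinear functions and signs\<close>

lemma sum_fun_apply: "(\<Sum>i\<in>I. f i) x = (\<Sum>i\<in>I. (f i x :: 'b::comm_monoid_add))"
  by (induction I rule: infinite_finite_induct) simp_all

lemma pairing_add_left: "pairing (d + d') e = pairing d e + pairing d' e"
  and pairing_diff_left: "pairing (d - d') e = pairing d e - pairing d' e"
  and pairing_commute: "pairing d e = pairing e d"
  by (simp_all add: pairing_def algebra_simps sum.distrib sum_subtractf)

lemma pairing_add_right: "pairing e (d + d') = pairing e d + pairing e d'"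
  and pairing_diff_right: "pairing e (d - d') = pairing e d - pairing e d'"
  by (simp_all add: pairing_def algebra_simps sum.distrib sum_subtractf)

context schouten_jacobi
begin

notation scale_fun (infixr \<open>*\<^sub>D\<close> 75)

sublocale fun_space: vector_space scale_fun
  by unfold_locales
    (simp_all add: scale_fun_def fun_eq_iff scale_right_distrib scale_left_distrib)

lemma app_add: "(A + B) \<bullet> a = A \<bullet> a + B \<bullet> a"
  and app_diff: "(A - B) \<bullet> a = A \<bullet> a - B \<bullet> a"
  and app_minus: "(- A) \<bullet> a = - (A \<bullet> a)"
  and app_zero [simp]: "0 \<bullet> a = 0"
  and app_scale: "(c *\<^sub>D A) \<bullet> a = c *\<^sub>D (A \<bullet> a)"
  and app_lact: "lact x A \<bullet> a = lact x (A \<bullet> a)"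
  and app_of_alg [simp]: "of_alg x \<bullet> a = 0"
  by (simp_all add: app_def scale_fun_def fun_eq_iff lact_def of_alg_def)

lemma lact_add: "lact x (A + B) = lact x A + lact x B"
  and lact_diff: "lact x (A - B) = lact x A - lact x B"
  and lact_minus: "lact x (- A) = - lact x A"
  and lact_zero [simp]: "lact x 0 = 0"
  and lact_zero_left [simp]: "lact 0 A = 0"
  and lact_add_left: "lact (x + y) A = lact x A + lact y A"
  and lact_scale: "lact x (c *\<^sub>D A) = c *\<^sub>D lact x A"
  and lact_scale_left: "lact (c *\<^sub>k x) A = c *\<^sub>D lact x A"
  and lact_lact: "lact x (lact y A) = lact (x * y) A"
  and lact_one [simp]: "lact 1 A = A"
  and lact_of_alg: "lact x (of_alg y) = of_alg (x * y)"
  by (simp_all add: scale_fun_def fun_eq_iff lact_def algebra_simps mult.assoc of_alg_def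
      scale_mult_left scale_mult_right)

lemma of_alg_add: "of_alg (x + y) = of_alg x + (of_alg y :: 'a list \<Rightarrow> 'a)"
  and of_alg_zero [simp]: "of_alg 0 = (0 :: 'a list \<Rightarrow> 'a)"
  and of_alg_scale: "of_alg (c *\<^sub>k x) = c *\<^sub>D of_alg x"
  and of_alg_Nil [simp]: "of_alg x [] = (x::'a)"
  by (auto simp: of_alg_def scale_fun_def fun_eq_iff)

text \<open>
  The sign \<open>(-1)\<^sup>k\<close> of two bidegrees in \<open>\<int>\<^sup>n \<times> \<int>\<close>, taken as a scalar. An element
  of degree \<open>u\<close> for the product has degree \<open>u - \<omega>\<close> for the bracket.
\<close>

definition deg_sign :: "(int ^ 'n) \<times> int \<Rightarrow> (int ^ 'n) \<times> int \<Rightarrow> 'k" where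
  "deg_sign u v = (if even (pairing (fst u) (fst v) + snd u * snd v) then 1 else - 1)"

lemma deg_sign_commute: "deg_sign u v = deg_sign v u"
  by (simp add: deg_sign_def pairing_commute mult.commute)

lemma deg_sign_add_left: "deg_sign (u + v) w = deg_sign u w * deg_sign v w"
  and deg_sign_diff_left: "deg_sign (u - v) w = deg_sign u w * deg_sign v w"
  by (auto simp: deg_sign_def pairing_add_left pairing_diff_left algebra_simps)

lemma deg_sign_add_right: "deg_sign w (u + v) = deg_sign w u * deg_sign w v"
  and deg_sign_diff_right: "deg_sign w (u - v) = deg_sign w u * deg_sign w v"
  by (simp_all add: deg_sign_add_left deg_sign_diff_left deg_sign_commute[of w])

lemma deg_sign_square [simp]: "deg_sign u v * deg_sign u v = 1"
  and deg_sign_square_left [simp]: "deg_sign u v * (deg_sign u v * c) = c"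
  by (simp_all add: deg_sign_def)

lemma deg_sign_zero [simp]: "deg_sign 0 u = 1" "deg_sign u 0 = 1"
  by (simp_all add: deg_sign_def pairing_def)

lemmas deg_sign_simps = deg_sign_add_left deg_sign_diff_left deg_sign_add_right deg_sign_diff_right

text \<open>Asking only for equal parity lets the exponents of the definitions, which mix shifts by
  \<alpha> and by -\<alpha>, be matched with one form on bidegrees.\<close>

lemma sign_eq_deg_sign:
  assumes "even (k - (pairing (fst u) (fst v) + snd u * snd v))"
  shows "sign k D = deg_sign u v *\<^sub>D D"
proof -
  have "even k \<longleftrightarrow> even m" if "even (k - m)" for m :: int
    using that by presburger
  note this[OF assms]
  then show ?thesis by (auto simp: sign_def deg_sign_def)
qed

definition alg_deg :: "int ^ 'n \<Rightarrow> (int ^ 'n) \<times> int" where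
  "alg_deg e = (e, 0)"

text \<open>The bracket has bidegree -\<omega>, and evaluation at an element of degree e changes the
  bidegree by \<open>alg_deg e - \<omega>\<close>, which is the bracket bidegree of that
  element.\<close>

definition \<omega> :: "(int ^ 'n) \<times> int" where
  "\<omega> = (\<alpha>, 1)"

definition total_deg :: "nat \<Rightarrow> int ^ 'n \<Rightarrow> (int ^ 'n) \<times> int" where
  "total_deg i d = (d + int i *s \<alpha>, int i)"

lemma alg_deg_add: "alg_deg (d + e) = alg_deg d + alg_deg e"
  and alg_deg_zero [simp]: "alg_deg 0 = 0"
  by (simp_all add: alg_deg_def zero_prod_def)

lemma snd_deg [simp]: "snd (alg_deg e) = 0" "snd \<omega> = 1" "snd (total_deg i d) = int i"
  by (simp_all add: alg_deg_def \<omega>_def total_deg_def)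

lemma total_deg_zero: "total_deg 0 d = alg_deg d"
  and total_deg_add: "total_deg i (d + e) = total_deg i d + alg_deg e"
  and total_deg_Suc: "total_deg (Suc i) d = total_deg i d + \<omega>"
  by (simp_all add: total_deg_def alg_deg_def \<omega>_def vector_sadd_rdistrib algebra_simps)

text \<open>No evaluation \<open>D \<bullet> a\<close> sees the value at the empty list; fixing it
  to be 0 is what lets the evaluations determine \<open>D\<close>.\<close>

definition first_linear :: "('a list \<Rightarrow> 'a) \<Rightarrow> bool" where
  "first_linear D \<longleftrightarrow> D [] = 0 \<and> (\<forall>a b. D \<bullet> (a + b) = D \<bullet> a + D \<bullet> b) \<and>
     (\<forall>c a. D \<bullet> (c *\<^sub>k a) = c *\<^sub>D (D \<bullet> a))"

lemma linear_app_iff: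
  "D [] = 0 \<and> Vector_Spaces.linear scale scale_fun (app D) \<longleftrightarrow> first_linear D"
  unfolding first_linear_def
  by (simp add: Vector_Spaces.linear_iff_module_hom module_hom_iff
      module_axioms fun_space.module_axioms)

lemma first_linear_zero: "first_linear 0"
  and first_linear_add: "first_linear D \<Longrightarrow> first_linear D' \<Longrightarrow> first_linear (D + D')"
  and first_linear_minus: "first_linear D \<Longrightarrow> first_linear (- D)"
  and first_linear_diff: "first_linear D \<Longrightarrow> first_linear D' \<Longrightarrow> first_linear (D - D')"
  and first_linear_scale: "first_linear D \<Longrightarrow> first_linear (c *\<^sub>D D)"
  and first_linear_lact: "first_linear D \<Longrightarrow> first_linear (lact x D)"
  unfolding first_linear_def
  by (simp_all add: app_add app_minus app_diff app_scale app_lact lact_add lact_scale algebra_simps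
      fun_space.scale_right_distrib fun_space.scale_right_diff_distrib mult.commute)
    (simp_all add: scale_fun_def lact_def)

lemma first_linear_additive: "first_linear D \<Longrightarrow> additive (app D)"
  by (simp add: first_linear_def additive_def)

lemma app_zero_right [simp]: "first_linear D \<Longrightarrow> D \<bullet> 0 = 0"
  using additive.zero[OF first_linear_additive] .

lemma first_linear_app:
  assumes "first_linear D"
  shows "D \<bullet> a = (\<Sum>e | component G a e \<noteq> 0. D \<bullet> component G a e)"
  using additive.sum[OF first_linear_additive[OF assms],
      of "component G a" "{e. component G a e \<noteq> 0}"]
  by (simp add: grading.sum_component)

lemma first_linear_eqI:
  assumes "first_linear D" "first_linear D'" "\<And>e a. a \<in> G e \<Longrightarrow> D \<bullet> a = D' \<bullet> a"
  shows "D = D'"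
proof
  fix xs show "D xs = D' xs"
  proof (cases xs)
    case Nil
    then show ?thesis using assms by (simp add: first_linear_def)
  next
    case (Cons a ys)
    have "D \<bullet> a = D' \<bullet> a"
      unfolding first_linear_app[OF assms(1), of a] first_linear_app[OF assms(2), of a]
      by (intro sum.cong refl assms(3)[OF component_G_mem])
    then show ?thesis using Cons by (auto simp: app_def fun_eq_iff)
  qed
qed

text \<open>A common finite \<open>F\<close> for the components of a, b and a + b is what makes
  additivity of \<open>lin_ext\<close> a termwise statement.\<close>

lemma lin_ext_eq:
  assumes "finite F" "{e. component G a e \<noteq> 0} \<subseteq> F" "\<And>e. \<phi> e 0 = 0"
  shows "lin_ext \<phi> \<bullet> a = (\<Sum>e\<in>F. \<phi> e (component G a e))"
proof
  fix ys
  have "lin_ext \<phi> \<bullet> a = (\<Sum>e | component G a e \<noteq> 0. \<phi> e (component G a e))"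
    by (simp add: lin_ext_def app_def fun_eq_iff sum_fun_apply)
  also have "\<dots> = (\<Sum>e\<in>F. \<phi> e (component G a e))"
    using assms by (intro sum.mono_neutral_left) auto
  finally show "(lin_ext \<phi> \<bullet> a) ys = (\<Sum>e\<in>F. \<phi> e (component G a e)) ys" by simp
qed

lemma lin_ext_homogeneous:
  assumes "a \<in> G e" "\<And>e. \<phi> e 0 = 0"
  shows "lin_ext \<phi> \<bullet> a = \<phi> e a"
proof -
  have "{d. component G a d \<noteq> 0} \<subseteq> {e}"
    by (auto simp: grading.component_homogeneous[OF assms(1)] split: if_splits)
  from lin_ext_eq[where \<phi> = \<phi>, OF _ this assms(2)] show ?thesis
    by (simp add: grading.component_homogeneous[OF assms(1)])
qed

lemma lin_ext_Nil [simp]: "lin_ext \<phi> [] = 0"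
  by (simp add: lin_ext_def)

lemma first_linear_lin_ext:
  assumes add: "\<And>e a b. a \<in> G e \<Longrightarrow> b \<in> G e \<Longrightarrow> \<phi> e (a + b) = \<phi> e a + \<phi> e b"
    and scl: "\<And>e a c. a \<in> G e \<Longrightarrow> \<phi> e (c *\<^sub>k a) = c *\<^sub>D \<phi> e a"
  shows "first_linear (lin_ext \<phi>)"
proof -
  have 0: "\<phi> e 0 = 0" for e
    using scl[of 0 e 0] grading.zero_mem by simp
  let ?S = "\<lambda>a. {e. component G a e \<noteq> 0}"
  have "lin_ext \<phi> \<bullet> (a + b) = lin_ext \<phi> \<bullet> a + lin_ext \<phi> \<bullet> b" for a b
  proof -
    have fin: "finite (?S a \<union> ?S b)" by (simp add: grading.finite_component)
    have sub: "?S (a + b) \<subseteq> ?S a \<union> ?S b" by (auto simp: component_G_add)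
    have "lin_ext \<phi> \<bullet> (a + b) = (\<Sum>e\<in>?S a \<union> ?S b. \<phi> e (component G (a + b) e))"
      using sub by (intro lin_ext_eq fin 0) auto
    also have "\<dots> = (\<Sum>e\<in>?S a \<union> ?S b. \<phi> e (component G a e) + \<phi> e (component G b e))"
      by (simp add: component_G_add add)
    finally show ?thesis
      using lin_ext_eq[where \<phi> = \<phi>, OF fin Un_upper1 0]
        lin_ext_eq[where \<phi> = \<phi>, OF fin Un_upper2 0] by (simp add: sum.distrib)
  qed
  moreover have "lin_ext \<phi> \<bullet> (c *\<^sub>k a) = c *\<^sub>D (lin_ext \<phi> \<bullet> a)" for c a
  proof -
    have fin: "finite (?S a)" by (simp add: grading.finite_component)
    have "lin_ext \<phi> \<bullet> (c *\<^sub>k a) = (\<Sum>e\<in>?S a. \<phi> e (component G (c *\<^sub>k a) e))"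
      by (intro lin_ext_eq fin 0) (auto simp: component_G_scale)
    also have "\<dots> = (\<Sum>e\<in>?S a. c *\<^sub>D \<phi> e (component G a e))"
      by (simp add: component_G_scale scl)
    finally show ?thesis
      using lin_ext_eq[where \<phi> = \<phi>, OF fin order_refl 0]
      by (simp add: fun_space.scale_sum_right)
  qed
  ultimately show ?thesis
    by (simp add: first_linear_def)
qed

lemma lin_ext_cong:
  assumes "\<And>e a. a \<in> G e \<Longrightarrow> \<phi> e a = \<psi> e a"
  shows "lin_ext \<phi> = lin_ext \<psi>"
  by (auto simp: lin_ext_def fun_eq_iff assms split: list.split)

lemma lin_ext_add: "lin_ext (\<lambda>e a. \<phi> e a + \<psi> e a) = lin_ext \<phi> + lin_ext \<psi>"
  and lin_ext_scale: "lin_ext (\<lambda>e a. c *\<^sub>D \<phi> e a) = c *\<^sub>D lin_ext \<phi>"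
  and lin_ext_lact: "lin_ext (\<lambda>e a. lact x (\<phi> e a)) = lact x (lin_ext \<phi>)"
  by (auto simp: lin_ext_def fun_eq_iff sum.distrib scale_fun_def lact_def scale_sum_right
      sum_distrib_left split: list.split)

end

section \<open>Homogeneous elements\<close>

context schouten_jacobi
begin

section \<open>The defining conditions of operators with scalar signs\<close>

lemma ract_eq: "ract i d D e a = deg_sign (alg_deg e) (total_deg i d) *\<^sub>D lact a D"
  unfolding ract_def by (rule sign_eq_deg_sign) (simp add: alg_deg_def total_deg_def)

lemma sign_alg_deg:
  "sign (pairing e (d + int i *s \<alpha>)) D = deg_sign (alg_deg e) (total_deg i d) *\<^sub>D D"
  by (rule sign_eq_deg_sign) (simp add: alg_deg_def total_deg_def)

text \<open>The minus sign is the product of the two genus shifts by -1. Trading \<alpha> for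
  -\<alpha> in both arguments changes the exponent by twice the pairing of e + f with \<alpha>,
  which is even.\<close>

lemma minus_sign_shifted:
  "- sign (pairing (e + \<alpha>) (f + \<alpha>)) D = deg_sign (alg_deg e - \<omega>) (alg_deg f - \<omega>) *\<^sub>D D"
proof -
  have "- sign (pairing (e + \<alpha>) (f + \<alpha>)) D = sign (pairing (e + \<alpha>) (f + \<alpha>) + 1) D"
    by (simp add: sign_def)
  also have "\<dots> = deg_sign (alg_deg e - \<omega>) (alg_deg f - \<omega>) *\<^sub>D D"
    by (rule sign_eq_deg_sign)
      (simp add: alg_deg_def \<omega>_def pairing_add_left pairing_diff_left
        pairing_add_right pairing_diff_right)
  finally show ?thesis .
qed

text \<open>\<open>total_deg i d\<close> is the bracket bidegree of \<open>D\<close>, since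
  \<open>D\<close> itself has genus \<open>Suc i\<close>, and also the product bidegree of
  \<open>D \<bullet> 1\<close>. The coefficients are thus the Koszul signs for moving algebra
  elements past \<open>D\<close> or past its values.\<close>

lemma DO_Suc_iff:
  "D \<in> DO (Suc i) d \<longleftrightarrow> first_linear D \<and> (\<forall>e. \<forall>a\<in>G e. D \<bullet> a \<in> DO i (d + e)) \<and>
     (\<forall>e f. \<forall>a\<in>G e. \<forall>b\<in>G f. D \<bullet> (a * b) =
          deg_sign (alg_deg f) (total_deg i d + alg_deg e) *\<^sub>D lact b (D \<bullet> a)
        + deg_sign (alg_deg e) (total_deg i d) *\<^sub>D lact a (D \<bullet> b)
        - deg_sign (alg_deg e + alg_deg f) (total_deg i d) *\<^sub>D lact (a * b) (D \<bullet> 1)) \<and>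
     (i > 0 \<longrightarrow> (\<forall>e f. \<forall>a\<in>G e. \<forall>b\<in>G f.
        D \<bullet> a \<bullet> b = deg_sign (alg_deg e - \<omega>) (alg_deg f - \<omega>) *\<^sub>D (D \<bullet> b \<bullet> a)))"
  unfolding DO.simps(2) mem_Collect_eq ract_eq sign_alg_deg minus_sign_shifted
    linear_app_iff[symmetric] total_deg_add alg_deg_add
  by blast

lemma first_linear_DO_Suc: "D \<in> DO (Suc i) d \<Longrightarrow> first_linear D"
  and DO_Suc_app: "D \<in> DO (Suc i) d \<Longrightarrow> a \<in> G e \<Longrightarrow> D \<bullet> a \<in> DO i (d + e)"
  and DO_Suc_app_mult: "D \<in> DO (Suc i) d \<Longrightarrow> a \<in> G e \<Longrightarrow> b \<in> G f \<Longrightarrow> D \<bullet> (a * b) =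
          deg_sign (alg_deg f) (total_deg i d + alg_deg e) *\<^sub>D lact b (D \<bullet> a)
        + deg_sign (alg_deg e) (total_deg i d) *\<^sub>D lact a (D \<bullet> b)
        - deg_sign (alg_deg e + alg_deg f) (total_deg i d) *\<^sub>D lact (a * b) (D \<bullet> 1)"
  and DO_Suc_app_app: "D \<in> DO (Suc i) d \<Longrightarrow> i > 0 \<Longrightarrow> a \<in> G e \<Longrightarrow> b \<in> G f \<Longrightarrow>
     D \<bullet> a \<bullet> b = deg_sign (alg_deg e - \<omega>) (alg_deg f - \<omega>) *\<^sub>D (D \<bullet> b \<bullet> a)"
  unfolding DO_Suc_iff by blast+

declare DO.simps(2) [simp del]

section \<open>Operator spaces are subspaces, stable under left multiplication\<close>

lemma zero_mem_DO: "0 \<in> DO i d"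
proof -
  have "z \<in> DO i d" if "z = 0" for z
    using that
  proof (induction i arbitrary: d)
    case 0
    have "of_alg 0 \<in> of_alg ` G d" using grading.zero_mem by blast
    then show ?case using 0 by (simp only: of_alg_zero DO.simps)
  next
    case (Suc i)
    then show ?case by (simp add: DO_Suc_iff first_linear_zero flip: zero_fun_def)
  qed
  then show ?thesis by simp
qed

lemma add_mem_DO: "D \<in> DO i d \<Longrightarrow> D' \<in> DO i d \<Longrightarrow> D + D' \<in> DO i d"
proof (induction i arbitrary: d D D')
  case 0
  then obtain x y where "D = of_alg x" "D' = of_alg y" "x \<in> G d" "y \<in> G d" by auto
  then have "D + D' = of_alg (x + y)" "x + y \<in> G d"
    by (simp_all add: of_alg_add grading.add_mem)
  then show ?case by simp
next
  case (Suc i)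
  show ?case
    unfolding DO_Suc_iff
  proof (intro conjI allI ballI impI)
    show "first_linear (D + D')"
      using Suc.prems by (simp add: first_linear_add first_linear_DO_Suc)
    show "(D + D') \<bullet> a \<in> DO i (d + e)" if "a \<in> G e" for a e
      using Suc.prems that by (simp add: app_add Suc.IH DO_Suc_app)
    fix e f a b assume ab: "a \<in> G e" "b \<in> G f"
    note mult = DO_Suc_app_mult[OF Suc.prems(1) ab] DO_Suc_app_mult[OF Suc.prems(2) ab]
    show "(D + D') \<bullet> (a * b) =
          deg_sign (alg_deg f) (total_deg i d + alg_deg e) *\<^sub>D lact b ((D + D') \<bullet> a)
        + deg_sign (alg_deg e) (total_deg i d) *\<^sub>D lact a ((D + D') \<bullet> b)
        - deg_sign (alg_deg e + alg_deg f) (total_deg i d) *\<^sub>D lact (a * b) ((D + D') \<bullet> 1)"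
      by (simp add: app_add mult lact_add fun_space.scale_right_distrib)
    show "(D + D') \<bullet> a \<bullet> b = deg_sign (alg_deg e - \<omega>) (alg_deg f - \<omega>) *\<^sub>D ((D + D') \<bullet> b \<bullet> a)"
      if "i > 0"
      using DO_Suc_app_app[OF Suc.prems(1) that ab] DO_Suc_app_app[OF Suc.prems(2) that ab]
      by (simp add: app_add fun_space.scale_right_distrib)
  qed
qed

lemma scale_mem_DO: "D \<in> DO i d \<Longrightarrow> c *\<^sub>D D \<in> DO i d"
proof (induction i arbitrary: d D)
  case 0
  then obtain x where "D = of_alg x" "x \<in> G d" by auto
  then have "c *\<^sub>D D = of_alg (c *\<^sub>k x)" "c *\<^sub>k x \<in> G d"
    using subspace_scale[OF subspace_G] by (simp_all add: of_alg_scale)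
  then show ?case by simp
next
  case (Suc i)
  show ?case
    unfolding DO_Suc_iff
  proof (intro conjI allI ballI impI)
    show "first_linear (c *\<^sub>D D)"
      using Suc.prems by (simp add: first_linear_scale first_linear_DO_Suc)
    show "(c *\<^sub>D D) \<bullet> a \<in> DO i (d + e)" if "a \<in> G e" for a e
      using Suc.prems that by (simp add: app_scale Suc.IH DO_Suc_app)
    fix e f a b assume ab: "a \<in> G e" "b \<in> G f"
    show "(c *\<^sub>D D) \<bullet> (a * b) =
          deg_sign (alg_deg f) (total_deg i d + alg_deg e) *\<^sub>D lact b ((c *\<^sub>D D) \<bullet> a)
        + deg_sign (alg_deg e) (total_deg i d) *\<^sub>D lact a ((c *\<^sub>D D) \<bullet> b)
        - deg_sign (alg_deg e + alg_deg f) (total_deg i d) *\<^sub>D lact (a * b) ((c *\<^sub>D D) \<bullet> 1)"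
      by (simp add: app_scale DO_Suc_app_mult[OF Suc.prems ab] lact_scale mult.commute
          fun_space.scale_right_distrib fun_space.scale_right_diff_distrib)
    show "(c *\<^sub>D D) \<bullet> a \<bullet> b = deg_sign (alg_deg e - \<omega>) (alg_deg f - \<omega>) *\<^sub>D ((c *\<^sub>D D) \<bullet> b \<bullet> a)"
      if "i > 0"
      using DO_Suc_app_app[OF Suc.prems that ab] by (simp add: app_scale mult.commute)
  qed
qed

lemma lact_commute:
  assumes "x \<in> G d" "y \<in> G e"
  shows "lact x (lact y A) = deg_sign (alg_deg d) (alg_deg e) *\<^sub>D lact y (lact x A)"
proof (cases "even (pairing d e)")
  case True
  then have "x * y = y * x" using graded_comm[OF assms] by (simp only: sign_def if_True)
  with True show ?thesis by (simp add: lact_lact deg_sign_def alg_deg_def)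
next
  case False
  then have "x * y = - (y * x)" using graded_comm[OF assms] by (simp only: sign_def if_False)
  moreover have "lact (- z) A = - lact z A" for z
    by (simp add: lact_def fun_eq_iff)
  ultimately show ?thesis using False by (simp only: lact_lact) (simp add: deg_sign_def alg_deg_def)
qed

text \<open>The sign of moving a, b or ab past x is exactly the change of the coefficients caused by
  raising the degree of \<open>D\<close> by c, so graded commutativity preserves the first order
  condition.\<close>

lemma lact_mem_DO: "D \<in> DO i d \<Longrightarrow> x \<in> G c \<Longrightarrow> lact x D \<in> DO i (c + d)"
proof (induction i arbitrary: d D)
  case 0
  then obtain y where "D = of_alg y" "y \<in> G d" by auto
  then have "lact x D = of_alg (x * y)" "x * y \<in> G (c + d)"
    using mult_G[OF 0(2)] by (simp_all add: lact_of_alg)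
  then show ?case by simp
next
  case (Suc i)
  have [simp]: "total_deg i (c + d) = total_deg i d + alg_deg c"
    using total_deg_add[of i d c] by (simp only: add.commute)
  have D: "first_linear D" "\<And>e a. a \<in> G e \<Longrightarrow> D \<bullet> a \<in> DO i (d + e)"
    using Suc.prems by (auto simp: DO_Suc_iff)
  note leib = DO_Suc_app_mult[OF Suc.prems(1)] and anti = DO_Suc_app_app[OF Suc.prems(1)]
  show ?case
    unfolding DO_Suc_iff
  proof (intro conjI allI ballI impI)
    show "first_linear (lact x D)" using D by (simp add: first_linear_lact)
    show "lact x D \<bullet> a \<in> DO i (c + d + e)" if "a \<in> G e" for a e
      using Suc.IH[OF D(2)[OF that] Suc.prems(2)] by (simp add: app_lact add_ac)
    fix e f a b assume a: "a \<in> G e" and b: "b \<in> G f"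
    show "lact x D \<bullet> (a * b) =
          deg_sign (alg_deg f) (total_deg i (c + d) + alg_deg e) *\<^sub>D lact b (lact x D \<bullet> a)
        + deg_sign (alg_deg e) (total_deg i (c + d)) *\<^sub>D lact a (lact x D \<bullet> b)
        - deg_sign (alg_deg e + alg_deg f) (total_deg i (c + d)) *\<^sub>D lact (a * b) (lact x D \<bullet> 1)"
      unfolding app_lact leib[OF a b] lact_add lact_diff lact_scale lact_commute[OF Suc.prems(2) a]
        lact_commute[OF Suc.prems(2) b]
        lact_commute[OF Suc.prems(2) mult_G[OF a b]]
      by (simp add: deg_sign_simps alg_deg_add deg_sign_commute[of _ "alg_deg c"] mult_ac)
    show "lact x D \<bullet> a \<bullet> b = deg_sign (alg_deg e - \<omega>) (alg_deg f - \<omega>) *\<^sub>D (lact x D \<bullet> b \<bullet> a)"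
      if "i > 0"
      using anti[OF that a b] by (simp add: app_lact lact_scale)
  qed
qed

lemma subspace_DO: "fun_space.subspace (DO i d)"
  by (rule fun_space.subspaceI) (simp_all add: zero_mem_DO add_mem_DO scale_mem_DO)

section \<open>Independence of the operator spaces\<close>

lemma DO_vanish: "D \<in> DO i d \<Longrightarrow> length xs \<noteq> i \<Longrightarrow> D xs = 0"
proof (induction i arbitrary: d D xs)
  case 0
  then show ?case by (auto simp: of_alg_def)
next
  case (Suc i)
  have lin: "first_linear D" using Suc.prems(1) by (rule first_linear_DO_Suc)
  show ?case
  proof (cases xs)
    case Nil
    then show ?thesis using lin by (simp add: first_linear_def)
  next
    case (Cons a ys)
    have "(D \<bullet> component G a e) ys = 0" for e
      by (rule Suc.IH[OF DO_Suc_app[OF Suc.prems(1) component_G_mem]])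
        (use Suc.prems Cons in auto)
    then have "(D \<bullet> a) ys = 0"
      by (subst first_linear_app[OF lin]) (simp add: sum_fun_apply)
    then show ?thesis by (simp add: Cons app_def)
  qed
qed

lemma DO_apply_mem:
  "D \<in> DO i d \<Longrightarrow> list_all2 (\<lambda>x e. x \<in> G e) xs es \<Longrightarrow> D xs \<in> G (d + sum_list es)"
proof (induction i arbitrary: d D xs es)
  case 0
  then show ?case by (cases xs) (auto simp: of_alg_def grading.zero_mem)
next
  case (Suc i)
  show ?case
  proof (cases xs)
    case Nil
    then show ?thesis
      using first_linear_DO_Suc[OF Suc.prems(1)] by (simp add: first_linear_def grading.zero_mem)
  next
    case (Cons a ys)
    with Suc.prems obtain e es' where es: "es = e # es'" "a \<in> G e" "list_all2 (\<lambda>x e. x \<in> G e) ys es'"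
      by (auto simp: list_all2_Cons1)
    from Suc.IH[OF DO_Suc_app[OF Suc.prems(1) es(2)] es(3)] show ?thesis
      by (simp add: Cons app_def es(1) add_ac)
  qed
qed

lemma DO_eq_zeroI:
  assumes "D \<in> DO i d"
    and "\<And>xs es. length xs = i \<Longrightarrow> list_all2 (\<lambda>x e. x \<in> G e) xs es \<Longrightarrow> D xs = 0"
  shows "D = 0"
  using assms
proof (induction i arbitrary: d D)
  case 0
  from 0(2)[of "[]" "[]"] 0(1) show ?case by auto
next
  case (Suc i)
  show ?case
  proof (rule first_linear_eqI[OF first_linear_DO_Suc[OF Suc.prems(1)] first_linear_zero])
    fix e a assume a: "a \<in> G e"
    have "D \<bullet> a = 0"
    proof (rule Suc.IH[OF DO_Suc_app[OF Suc.prems(1) a]])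
      fix xs es assume "length xs = i" "list_all2 (\<lambda>x e. x \<in> G e) xs es"
      then show "(D \<bullet> a) xs = 0"
        using Suc.prems(2)[of "a # xs" "e # es"] a by (simp add: app_def)
    qed
    then show "D \<bullet> a = 0 \<bullet> a" by simp
  qed
qed

text \<open>Testing a vanishing sum on a homogeneous list of length i and total degree s keeps only
  genus i, and the summand of degree q takes its value in \<open>G (q + s)\<close>. Different q give
  different degrees, so independence in the algebra kills each value.\<close>

sublocale DO: independent_family DO_family
proof
  fix f and k :: "nat \<times> (int ^ 'n)"
  assume f: "is_decomposition DO_family 0 f"
  obtain i d where k: "k = (i, d)" by (cases k)
  let ?S = "{l. f l \<noteq> 0}"
  have fin: "finite ?S" and mem: "\<And>j q. f (j, q) \<in> DO j q" and sum: "0 = sum f ?S"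
    using f unfolding is_decomposition_def DO_family_def by auto
  have "f (i, d) = 0"
  proof (rule DO_eq_zeroI[OF mem])
    fix xs es assume xs: "length xs = i" "list_all2 (\<lambda>x e. x \<in> G e) xs es"
    define s where "s = sum_list es"
    let ?g = "\<lambda>e. f (i, e - s) xs"
    \<comment> \<open>Degrees coming from every genus are included. If e stems only from another
      genus, then \<open>f (i, e - s)\<close> is 0 and the extra index does no harm.\<close>
    let ?F = "(\<lambda>(j, q). q + s) ` ?S"
    have "is_decomposition G 0 ?g"
    proof (rule grading.is_decompositionI[where F = ?F])
      show "finite ?F" using fin by simp
      show "f (i, e - s) xs = 0" if "e \<notin> ?F" for e
      proof -
        have "(i, e - s) \<notin> ?S" using that by (metis (mono_tags, lifting) case_prod_conv diff_add_cancel image_eqI)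
        then show ?thesis by simp
      qed
      show "f (i, e - s) xs \<in> G e" for e
        using DO_apply_mem[OF mem xs(2), of i "e - s"] by (simp add: s_def)
      have "0 = (\<Sum>l\<in>?S. f l xs)"
        using sum by (metis sum_fun_apply zero_fun_def)
      \<comment> \<open>The pulled back index set contains the whole support in genus i; support in
        another genus vanishes at \<open>xs\<close> because of its length.\<close>
      also have "\<dots> = (\<Sum>l\<in>Pair i ` (\<lambda>e. e - s) ` ?F. f l xs)"
      proof (rule sum.mono_neutral_cong)
        show "f l xs = 0" if "l \<in> ?S - Pair i ` (\<lambda>e. e - s) ` ?F" for l
        proof -
          obtain j q where l: "l = (j, q)" by (cases l)
          have "j \<noteq> i" using that unfolding l by (metis (mono_tags, lifting) DiffE add_diff_cancel_right' case_prod_conv image_eqI)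
          then have "length xs \<noteq> j" using xs(1) by simp
          from DO_vanish[OF mem this] show ?thesis unfolding l .
        qed
      qed (use fin in auto)
      also have "\<dots> = (\<Sum>e\<in>?F. ?g e)"
        by (simp add: sum.reindex inj_on_def)
      finally show "0 = (\<Sum>e\<in>?F. ?g e)" .
    qed
    from grading.independent[OF this, of "d + s"] show "f (i, d) xs = 0" by simp
  qed
  then show "f k = 0" by (simp add: k)
next
  fix x and k :: "nat \<times> (int ^ 'n)" assume "x \<in> DO_family k"
  then show "- x \<in> DO_family k"
    using fun_space.subspace_neg[OF subspace_DO] by (auto simp: DO_family_def split: prod.splits)
qed (auto simp: DO_family_def zero_mem_DO add_mem_DO)

end

section \<open>Bilinearity of the product and the bracket\<close>

text \<open>
  From here on identities in \<^typ>\<open>'a list \<Rightarrow> 'a\<close> are proved without evaluating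
  at lists; the pointwise rules would rewrite eta-expanded sums.
\<close>

declare plus_fun_apply [simp del] zero_fun_apply [simp del] minus_apply [simp del]
  uminus_apply [simp del]

text \<open>Mirrors the recursion of \<open>prod_hom\<close> and \<open>bracket_hom\<close>, whose
  two summands lower one genus each and keep the other.\<close>

lemma double_nat_induct [case_names zero_left zero_right Suc_Suc]:
  assumes "\<And>j. P 0 j" "\<And>i. P (Suc i) 0"
    and "\<And>i j. P i (Suc j) \<Longrightarrow> P (Suc i) j \<Longrightarrow> P (Suc i) (Suc j)"
  shows "P i j"
proof (induction i arbitrary: j)
  case (Suc i)
  show ?case by (induction j) (use assms Suc in auto)
qed (rule assms(1))

context schouten_jacobi
begin

section \<open>The recursions with scalar signs\<close>

lemmas fun_scale_simps = fun_space.scale_right_distrib fun_space.scale_right_diff_distrib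

lemma prod_hom_Suc_0:
  "prod_hom (Suc i) p 0 q A B = deg_sign (alg_deg q) (total_deg (Suc i) p) *\<^sub>D lact (B []) A"
  by (simp add: ract_eq)

lemma prod_hom_Suc_Suc:
  "prod_hom (Suc i) p (Suc j) q A B = lin_ext (\<lambda>e a.
     deg_sign (alg_deg e - \<omega>) (total_deg (Suc j) q) *\<^sub>D prod_hom i (p + e) (Suc j) q (A \<bullet> a) B
     + prod_hom (Suc i) p j (q + e) A (B \<bullet> a))"
proof -
  have "sign (pairing (e + \<alpha>) (q + int (Suc j) *s \<alpha>) + int (Suc j)) D =
      deg_sign (alg_deg e - \<omega>) (total_deg (Suc j) q) *\<^sub>D D" for e D
    by (rule sign_eq_deg_sign)
      (simp add: alg_deg_def \<omega>_def total_deg_def pairing_add_left pairing_diff_left)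
  then show ?thesis by simp
qed

text \<open>Graded antisymmetry in its simplest instance: \<open>total_deg j q\<close> is the
  bracket bidegree of \<open>B\<close>, and the exponent \<open>Suc j\<close> in place of j accounts
  for the minus sign.\<close>

lemma bracket_hom_0_Suc:
  "bracket_hom 0 p (Suc j) q A B =
     - (deg_sign (alg_deg p - \<omega>) (total_deg j q) *\<^sub>D (B \<bullet> (A [])))"
proof -
  have "sign (k + int (Suc j)) D = - sign (k + int j) D" for k D by (simp add: sign_def)
  then have "bracket_hom 0 p (Suc j) q A B = - sign (pairing (p - \<alpha>) (q + int j *s \<alpha>) + int j) (B \<bullet> (A []))"
    by simp
  moreover have "sign (pairing (p - \<alpha>) (q + int j *s \<alpha>) + int j) D =
      deg_sign (alg_deg p - \<omega>) (total_deg j q) *\<^sub>D D" for D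
    by (rule sign_eq_deg_sign) (simp add: alg_deg_def \<omega>_def total_deg_def)
  ultimately show ?thesis by simp
qed

lemma bracket_hom_Suc_Suc:
  "bracket_hom (Suc i) p (Suc j) q A B = lin_ext (\<lambda>e a.
     deg_sign (alg_deg e - \<omega>) (total_deg j q) *\<^sub>D bracket_hom i (p + e) (Suc j) q (A \<bullet> a) B
     + bracket_hom (Suc i) p j (q + e) A (B \<bullet> a))"
proof -
  have "sign (pairing (e - \<alpha>) (q + int j *s \<alpha>) + int j) D =
      deg_sign (alg_deg e - \<omega>) (total_deg j q) *\<^sub>D D" for e D
    by (rule sign_eq_deg_sign) (simp add: alg_deg_def \<omega>_def total_deg_def)
  then show ?thesis by simp
qed

declare prod_hom.simps(2,3) [simp del] bracket_hom.simps(3,4) [simp del]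

section \<open>Bilinearity and symmetry in fixed genus and degree\<close>

lemma add_fun_Nil: "(A + B) [] = A [] + (B [] :: 'a)"
  by (rule plus_fun_apply)

lemma prod_hom_add_left: "prod_hom i p j q (A + A') B = prod_hom i p j q A B + prod_hom i p j q A' B"
proof (induction i j arbitrary: p q A A' B rule: double_nat_induct)
  case (Suc_Suc i j)
  show ?case
    unfolding prod_hom_Suc_Suc lin_ext_add[symmetric]
    by (simp add: app_add Suc_Suc.IH fun_scale_simps ac_simps)
qed (simp_all add: prod_hom_Suc_0 add_fun_Nil lact_add lact_add_left fun_scale_simps)

lemma prod_hom_add_right: "prod_hom i p j q A (B + B') = prod_hom i p j q A B + prod_hom i p j q A B'"
proof (induction i j arbitrary: p q A B B' rule: double_nat_induct)
  case (Suc_Suc i j)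
  show ?case
    unfolding prod_hom_Suc_Suc lin_ext_add[symmetric]
    by (simp add: app_add Suc_Suc.IH fun_scale_simps ac_simps)
qed (simp_all add: prod_hom_Suc_0 add_fun_Nil lact_add lact_add_left fun_scale_simps)

lemma scale_fun_Nil: "(c *\<^sub>D A) [] = c *\<^sub>k A []"
  by (simp add: scale_fun_def)

lemma prod_hom_scale_left: "prod_hom i p j q (c *\<^sub>D A) B = c *\<^sub>D prod_hom i p j q A B"
proof (induction i j arbitrary: p q A B rule: double_nat_induct)
  case (Suc_Suc i j)
  show ?case
    unfolding prod_hom_Suc_Suc lin_ext_scale[symmetric]
    by (simp add: app_scale Suc_Suc.IH fun_scale_simps mult.commute)
qed (simp_all add: prod_hom_Suc_0 lact_scale lact_scale_left scale_fun_Nil mult.commute)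

lemma prod_hom_scale_right: "prod_hom i p j q A (c *\<^sub>D B) = c *\<^sub>D prod_hom i p j q A B"
proof (induction i j arbitrary: p q A B rule: double_nat_induct)
  case (Suc_Suc i j)
  show ?case
    unfolding prod_hom_Suc_Suc lin_ext_scale[symmetric]
    by (simp add: app_scale Suc_Suc.IH fun_scale_simps mult.commute)
qed (simp_all add: prod_hom_Suc_0 lact_scale lact_scale_left scale_fun_Nil mult.commute)

text \<open>Exchanging the factors exchanges the two summands of the recursion. Replacing A by A(a)
  multiplies the exchange sign by that of \<open>alg_deg e - \<omega>\<close> with B, which is
  precisely the coefficient of the first summand.\<close>

lemma prod_hom_commute:
  assumes "A \<in> DO i p" "B \<in> DO j q"
  shows "prod_hom i p j q A B = deg_sign (total_deg i p) (total_deg j q) *\<^sub>D prod_hom j q i p B A"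
  using assms
proof (induction i j arbitrary: p q A B rule: double_nat_induct)
  case (zero_left j)
  then obtain x where x: "A = of_alg x" "x \<in> G p" by auto
  show ?case
  proof (cases j)
    case 0
    with zero_left obtain y where y: "B = of_alg y" "y \<in> G q" by auto
    \<comment> \<open>Acting on \<open>of_alg 1\<close> expresses graded commutativity of x and y
      with the sign already turned into a scalar.\<close>
    have "lact x (lact y (of_alg 1)) = deg_sign (alg_deg p) (alg_deg q) *\<^sub>D lact y (lact x (of_alg 1))"
      by (rule lact_commute[OF x(2) y(2)])
    then show ?thesis by (simp add: 0 x y total_deg_zero lact_of_alg)
  next
    case (Suc k)
    then show ?thesis
      by (simp add: prod_hom_Suc_0 total_deg_zero deg_sign_commute[of "alg_deg p"])
  qed
next
  case (zero_right i)
  then show ?case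
    by (simp add: prod_hom_Suc_0 total_deg_zero deg_sign_commute[of "alg_deg q"])
next
  case (Suc_Suc i j)
  show ?case
    unfolding prod_hom_Suc_Suc lin_ext_scale[symmetric]
  proof (rule lin_ext_cong)
    fix e a assume a: "a \<in> G e"
    note IH = Suc_Suc.IH(1)[OF DO_Suc_app[OF Suc_Suc.prems(1) a] Suc_Suc.prems(2)]
      Suc_Suc.IH(2)[OF Suc_Suc.prems(1) DO_Suc_app[OF Suc_Suc.prems(2) a]]
    show "deg_sign (alg_deg e - \<omega>) (total_deg (Suc j) q) *\<^sub>D prod_hom i (p + e) (Suc j) q (A \<bullet> a) B
        + prod_hom (Suc i) p j (q + e) A (B \<bullet> a)
      = deg_sign (total_deg (Suc i) p) (total_deg (Suc j) q) *\<^sub>D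
        (deg_sign (alg_deg e - \<omega>) (total_deg (Suc i) p) *\<^sub>D prod_hom j (q + e) (Suc i) p (B \<bullet> a) A
        + prod_hom (Suc j) q i (p + e) B (A \<bullet> a))"
      unfolding IH
      by (simp add: total_deg_add total_deg_Suc deg_sign_simps fun_scale_simps mult_ac
          deg_sign_commute)
  qed
qed

lemma bracket_hom_commute:
  assumes "A \<in> DO i p" "B \<in> DO j q"
  shows "bracket_hom i p j q A B =
    - (deg_sign (total_deg i p - \<omega>) (total_deg j q - \<omega>) *\<^sub>D bracket_hom j q i p B A)"
  using assms
proof (induction i j arbitrary: p q A B rule: double_nat_induct)
  case (zero_left j)
  then show ?case
    by (cases j) (simp_all add: bracket_hom_0_Suc total_deg_zero total_deg_Suc)
next
  case (zero_right i)
  then show ?case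
    by (simp add: bracket_hom_0_Suc total_deg_zero total_deg_Suc
        deg_sign_commute[of "total_deg i p"])
next
  case (Suc_Suc i j)
  \<comment> \<open>The minus sign is absorbed into the scalar so that it can be pulled through
    \<open>lin_ext\<close>.\<close>
  have "bracket_hom (Suc i) p (Suc j) q A B =
      (- deg_sign (total_deg (Suc i) p - \<omega>) (total_deg (Suc j) q - \<omega>)) *\<^sub>D
        bracket_hom (Suc j) q (Suc i) p B A"
    unfolding bracket_hom_Suc_Suc lin_ext_scale[symmetric]
  proof (rule lin_ext_cong)
    fix e a assume a: "a \<in> G e"
    note IH = Suc_Suc.IH(1)[OF DO_Suc_app[OF Suc_Suc.prems(1) a] Suc_Suc.prems(2)]
      Suc_Suc.IH(2)[OF Suc_Suc.prems(1) DO_Suc_app[OF Suc_Suc.prems(2) a]]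
    show "deg_sign (alg_deg e - \<omega>) (total_deg j q) *\<^sub>D bracket_hom i (p + e) (Suc j) q (A \<bullet> a) B
        + bracket_hom (Suc i) p j (q + e) A (B \<bullet> a)
      = (- deg_sign (total_deg (Suc i) p - \<omega>) (total_deg (Suc j) q - \<omega>)) *\<^sub>D
        (deg_sign (alg_deg e - \<omega>) (total_deg i p) *\<^sub>D bracket_hom j (q + e) (Suc i) p (B \<bullet> a) A
        + bracket_hom (Suc j) q i (p + e) B (A \<bullet> a))"
      unfolding IH
      by (simp add: total_deg_add total_deg_Suc deg_sign_simps fun_scale_simps mult_ac
          deg_sign_commute)
  qed
  then show ?case by simp
qed

text \<open>Membership of B enters through the clause for genus 0, which evaluates B at
  \<open>A []\<close>: additivity in A is there linearity of B in its first argument.\<close>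

lemma bracket_hom_add_left:
  assumes "A \<in> DO i p" "A' \<in> DO i p" "B \<in> DO j q"
  shows "bracket_hom i p j q (A + A') B = bracket_hom i p j q A B + bracket_hom i p j q A' B"
  using assms
proof (induction i j arbitrary: p q A A' B rule: double_nat_induct)
  case (zero_left j)
  show ?case
  proof (cases j)
    case (Suc k)
    then have "first_linear B" using zero_left first_linear_DO_Suc by blast
    then show ?thesis by (simp add: Suc bracket_hom_0_Suc first_linear_def add_fun_Nil fun_scale_simps)
  qed simp
next
  case (Suc_Suc i j)
  show ?case
    unfolding bracket_hom_Suc_Suc lin_ext_add[symmetric]
  proof (rule lin_ext_cong)
    fix e a assume a: "a \<in> G e"
    note IH = Suc_Suc.IH(1)[OF DO_Suc_app[OF Suc_Suc.prems(1) a] DO_Suc_app[OF Suc_Suc.prems(2) a]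
        Suc_Suc.prems(3)]
      Suc_Suc.IH(2)[OF Suc_Suc.prems(1,2) DO_Suc_app[OF Suc_Suc.prems(3) a]]
    show "deg_sign (alg_deg e - \<omega>) (total_deg j q) *\<^sub>D
          bracket_hom i (p + e) (Suc j) q ((A + A') \<bullet> a) B
        + bracket_hom (Suc i) p j (q + e) (A + A') (B \<bullet> a)
      = deg_sign (alg_deg e - \<omega>) (total_deg j q) *\<^sub>D bracket_hom i (p + e) (Suc j) q (A \<bullet> a) B
        + bracket_hom (Suc i) p j (q + e) A (B \<bullet> a)
        + (deg_sign (alg_deg e - \<omega>) (total_deg j q) *\<^sub>D bracket_hom i (p + e) (Suc j) q (A' \<bullet> a) B
        + bracket_hom (Suc i) p j (q + e) A' (B \<bullet> a))"
      by (simp add: app_add IH fun_scale_simps)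
  qed
qed (simp add: app_add)

lemma bracket_hom_scale_left:
  assumes "A \<in> DO i p" "B \<in> DO j q"
  shows "bracket_hom i p j q (c *\<^sub>D A) B = c *\<^sub>D bracket_hom i p j q A B"
  using assms
proof (induction i j arbitrary: p q A B rule: double_nat_induct)
  case (zero_left j)
  show ?case
  proof (cases j)
    case (Suc k)
    then have "first_linear B" using zero_left first_linear_DO_Suc by blast
    then show ?thesis
      by (simp add: Suc bracket_hom_0_Suc first_linear_def scale_fun_Nil mult.commute)
  qed simp
next
  case (Suc_Suc i j)
  show ?case
    unfolding bracket_hom_Suc_Suc lin_ext_scale[symmetric]
    by (rule lin_ext_cong)
      (simp add: app_scale Suc_Suc.IH(1)[OF DO_Suc_app] Suc_Suc.IH(2)[OF _ DO_Suc_app]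
        Suc_Suc.prems fun_scale_simps mult.commute)
qed (simp add: app_scale)

text \<open>Antisymmetry transports the result for the left argument, which saves a second
  induction.\<close>

lemma bracket_hom_add_right:
  assumes "A \<in> DO i p" "B \<in> DO j q" "B' \<in> DO j q"
  shows "bracket_hom i p j q A (B + B') = bracket_hom i p j q A B + bracket_hom i p j q A B'"
  using assms bracket_hom_commute[OF assms(1,2)] bracket_hom_commute[OF assms(1,3)]
    bracket_hom_commute[OF assms(1) add_mem_DO[OF assms(2,3)]]
  by (simp add: bracket_hom_add_left fun_scale_simps)

lemma bracket_hom_scale_right:
  assumes "A \<in> DO i p" "B \<in> DO j q"
  shows "bracket_hom i p j q A (c *\<^sub>D B) = c *\<^sub>D bracket_hom i p j q A B"
  using assms bracket_hom_commute[OF assms] bracket_hom_commute[OF assms(1) scale_mem_DO[OF assms(2)]]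
  by (simp add: bracket_hom_scale_left mult.commute)

text \<open>Associativity with a leftmost factor in the algebra. If B is in the algebra too, the
  factor B must pass x, and the sign this costs is the change in the degree of the operator.\<close>

lemma prod_hom_lact:
  assumes "x \<in> G c" "A \<in> DO i p" "B \<in> DO j q"
  shows "prod_hom i (c + p) j q (lact x A) B = lact x (prod_hom i p j q A B)"
  using assms(2,3)
proof (induction i j arbitrary: p q A B rule: double_nat_induct)
  case (zero_left j)
  show ?case by (simp add: lact_lact) (simp add: lact_def)
next
  case (zero_right i)
  then obtain y where y: "B = of_alg y" "y \<in> G q" by auto
  show ?case
    using lact_commute[OF y(2) assms(1), of A]
    by (simp add: prod_hom_Suc_0 y lact_scale deg_sign_simps mult_ac
        total_deg_add add.commute[of c p])
next
  case (Suc_Suc i j)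
  have [simp]: "c + p + e = c + (p + e)" for e by (simp add: add.assoc)
  show ?case
    unfolding prod_hom_Suc_Suc lin_ext_lact[symmetric]
    by (rule lin_ext_cong)
      (simp add: app_lact lact_add lact_scale Suc_Suc.IH(1)[OF DO_Suc_app]
        Suc_Suc.IH(2)[OF _ DO_Suc_app] Suc_Suc.prems)
qed

subsection \<open>Extension to all elements\<close>

lemma DO_family_pair [simp]: "DO_family (i, d) = DO i d"
  by (simp add: DO_family_def)

lemma mem_DO_all: "A \<in> DO i p \<Longrightarrow> A \<in> DO_all"
  unfolding DO_all_def by (rule DO.mem_direct_sum[of _ "(i, p)"]) simp

lemma add_mem_DO_all [simp]: "A \<in> DO_all \<Longrightarrow> B \<in> DO_all \<Longrightarrow> A + B \<in> DO_all"
  unfolding DO_all_def by (rule DO.direct_sum_add)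

lemma DO_all_induct [consumes 1, case_names homogeneous add]:
  assumes "A \<in> DO_all"
    and "\<And>i p A. A \<in> DO i p \<Longrightarrow> Q A"
    and "\<And>A B. A \<in> DO_all \<Longrightarrow> B \<in> DO_all \<Longrightarrow> Q A \<Longrightarrow> Q B \<Longrightarrow> Q (A + B)"
  shows "Q A"
  using assms(1) unfolding DO_all_def
proof (induction rule: DO.direct_sum_induct)
  case (homogeneous d x)
  then show ?case using assms(2) by (cases d) auto
qed (use assms(3) in \<open>auto simp: DO_all_def\<close>)

lemma scale_mem_DO_all [simp]: "A \<in> DO_all \<Longrightarrow> c *\<^sub>D A \<in> DO_all"
  by (induction rule: DO_all_induct)
    (auto simp: fun_scale_simps intro: mem_DO_all scale_mem_DO simp del: DO.simps)

lemma zero_mem_DO_all [simp]: "0 \<in> DO_all"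
  by (rule mem_DO_all[OF zero_mem_DO])

lemma minus_mem_DO_all [simp]: "A \<in> DO_all \<Longrightarrow> - A \<in> DO_all"
  using scale_mem_DO_all[of A "- 1"] by simp

lemma diff_mem_DO_all [simp]: "A \<in> DO_all \<Longrightarrow> B \<in> DO_all \<Longrightarrow> A - B \<in> DO_all"
  using add_mem_DO_all[of A "- B"] by simp

lemma sum_mem_DO_all: "(\<And>x. x \<in> X \<Longrightarrow> f x \<in> DO_all) \<Longrightarrow> sum f X \<in> DO_all"
  by (induction X rule: infinite_finite_induct) auto

text \<open>For i = 0 the truncated difference is again 0, and the statement survives because the
  evaluation is then the zero function.\<close>

lemma app_mem_DO:
  assumes "A \<in> DO i p" "a \<in> G e"
  shows "A \<bullet> a \<in> DO (i - 1) (p + e)"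
proof (cases i)
  case 0
  then have "A \<bullet> a = 0" using assms(1) by auto
  then show ?thesis by (simp only: zero_mem_DO)
next
  case (Suc j)
  then show ?thesis using DO_Suc_app assms by simp
qed

text \<open>Common abstraction of the product and the bracket, so that the passage to sums is made
  once. Additivity is asked within a fixed genus and degree because \<mu> takes them as
  parameters.\<close>

definition bilinear_on_DO ::
    "(nat \<Rightarrow> int ^ 'n \<Rightarrow> nat \<Rightarrow> int ^ 'n \<Rightarrow> ('a list \<Rightarrow> 'a) \<Rightarrow> ('a list \<Rightarrow> 'a) \<Rightarrow> ('a list \<Rightarrow> 'a)) \<Rightarrow> bool"
  where "bilinear_on_DO \<mu> \<longleftrightarrow>
    (\<forall>i p j q A B C c. A \<in> DO i p \<and> B \<in> DO i p \<and> C \<in> DO j q \<longrightarrow>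
       \<mu> i p j q (A + B) C = \<mu> i p j q A C + \<mu> i p j q B C \<and>
       \<mu> i p j q (c *\<^sub>D A) C = c *\<^sub>D \<mu> i p j q A C \<and>
       \<mu> j q i p C (A + B) = \<mu> j q i p C A + \<mu> j q i p C B \<and>
       \<mu> j q i p C (c *\<^sub>D A) = c *\<^sub>D \<mu> j q i p C A)"

lemma bilinear_on_DO_prod_hom: "bilinear_on_DO prod_hom"
  unfolding bilinear_on_DO_def
  by (simp add: prod_hom_add_left prod_hom_add_right prod_hom_scale_left prod_hom_scale_right)

lemma bilinear_on_DO_bracket_hom: "bilinear_on_DO bracket_hom"
  unfolding bilinear_on_DO_def
  by (simp add: bracket_hom_add_left bracket_hom_add_right bracket_hom_scale_left
      bracket_hom_scale_right)

lemma component_DO_mem: "A \<in> DO_all \<Longrightarrow> component DO_family A (i, p) \<in> DO i p"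
  using DO.component_mem[of A "(i, p)"] by (simp add: DO_all_def)

lemma component_DO_mem': "A \<in> DO_all \<Longrightarrow> component DO_family A k \<in> DO (fst k) (snd k)"
  using component_DO_mem[of A "fst k" "snd k"] by simp

context
  fixes \<mu> assumes \<mu>: "bilinear_on_DO \<mu>"
begin

lemma bilinear_zero:
  assumes "C \<in> DO j q"
  shows "\<mu> i p j q 0 C = 0" "\<mu> j q i p C 0 = 0"
proof -
  have "\<mu> i p j q (0 *\<^sub>D 0) C = 0 *\<^sub>D \<mu> i p j q 0 C \<and> \<mu> j q i p C (0 *\<^sub>D 0) = 0 *\<^sub>D \<mu> j q i p C 0"
    using \<mu> assms zero_mem_DO[of i p] unfolding bilinear_on_DO_def by blast
  then show "\<mu> i p j q 0 C = 0" "\<mu> j q i p C 0 = 0" by simp_all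
qed

abbreviation \<mu>c where
  "\<mu>c A B k l \<equiv> \<mu> (fst k) (snd k) (fst l) (snd l) (component DO_family A k) (component DO_family B l)"

lemma bilin_ext_eq:
  assumes "A \<in> DO_all" "B \<in> DO_all" "finite K" "finite L"
    and "{k. component DO_family A k \<noteq> 0} \<subseteq> K" "{l. component DO_family B l \<noteq> 0} \<subseteq> L"
  shows "bilin_ext \<mu> A B = (\<Sum>k\<in>K. \<Sum>l\<in>L. \<mu>c A B k l)"
proof -
  have "bilin_ext \<mu> A B = (\<Sum>k | component DO_family A k \<noteq> 0. \<Sum>l | component DO_family B l \<noteq> 0. \<mu>c A B k l)"
    unfolding bilin_ext_def by (simp add: case_prod_unfold)
  also have "\<dots> = (\<Sum>k | component DO_family A k \<noteq> 0. \<Sum>l\<in>L. \<mu>c A B k l)"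
    by (intro sum.cong refl sum.mono_neutral_left)
      (use assms bilinear_zero(2)[OF component_DO_mem'[OF assms(1)]] in auto)
  also have "\<dots> = (\<Sum>k\<in>K. \<Sum>l\<in>L. \<mu>c A B k l)"
    by (intro sum.mono_neutral_left)
      (use assms bilinear_zero(1)[OF component_DO_mem'[OF assms(2)]] in auto)
  finally show ?thesis .
qed

text \<open>Valid for every genus and degree that A and B admit; only 0 admits several, and \<mu>
  vanishes on it.\<close>

lemma bilin_ext_homogeneous:
  assumes "A \<in> DO i p" "B \<in> DO j q"
  shows "bilin_ext \<mu> A B = \<mu> i p j q A B"
proof -
  have [simp]: "component DO_family A = (\<lambda>k. if k = (i, p) then A else 0)"
    "component DO_family B = (\<lambda>k. if k = (j, q) then B else 0)"
    using assms by (simp_all add: DO.component_homogeneous)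
  show ?thesis
    by (subst bilin_ext_eq[where K = "{(i, p)}" and L = "{(j, q)}"])
      (auto intro: mem_DO_all[OF assms(1)] mem_DO_all[OF assms(2)])
qed

lemma finite_component_DO: "A \<in> DO_all \<Longrightarrow> finite {k. component DO_family A k \<noteq> 0}"
  by (simp add: DO_all_def DO.finite_component)

lemma component_DO_add: "A \<in> DO_all \<Longrightarrow> B \<in> DO_all \<Longrightarrow>
    component DO_family (A + B) k = component DO_family A k + component DO_family B k"
  by (simp add: DO_all_def DO.component_add)

lemma component_DO_scale: "A \<in> DO_all \<Longrightarrow>
    component DO_family (c *\<^sub>D A) k = c *\<^sub>D component DO_family A k"
  unfolding DO_all_def
  by (rule DO.component_map) (auto simp: additive_def fun_scale_simps DO_family_def
      intro: scale_mem_DO simp del: DO.simps)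

lemma bilin_ext_add:
  assumes "A \<in> DO_all" "B \<in> DO_all" "C \<in> DO_all"
  shows "bilin_ext \<mu> (A + B) C = bilin_ext \<mu> A C + bilin_ext \<mu> B C"
    and "bilin_ext \<mu> C (A + B) = bilin_ext \<mu> C A + bilin_ext \<mu> C B"
proof -
  let ?c = "component DO_family"
  let ?K = "{k. ?c A k \<noteq> 0} \<union> {k. ?c B k \<noteq> 0}" and ?L = "{k. ?c C k \<noteq> 0}"
  have fin: "finite ?K" "finite ?L" using assms finite_component_DO by auto
  have sub: "{k. ?c (A + B) k \<noteq> 0} \<subseteq> ?K" using assms by (auto simp: component_DO_add)
  note AB = add_mem_DO_all[OF assms(1,2)]
  have hom: "\<mu>c (A + B) C k l = \<mu>c A C k l + \<mu>c B C k l"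
    "\<mu>c C (A + B) k l = \<mu>c C A k l + \<mu>c C B k l" for k l
    using \<mu> assms[THEN component_DO_mem', of k] assms[THEN component_DO_mem', of l]
    unfolding bilinear_on_DO_def by (simp_all add: component_DO_add assms)
  show "bilin_ext \<mu> (A + B) C = bilin_ext \<mu> A C + bilin_ext \<mu> B C"
    using bilin_ext_eq[OF AB assms(3) fin sub order_refl]
      bilin_ext_eq[OF assms(1,3) fin Un_upper1 order_refl]
      bilin_ext_eq[OF assms(2,3) fin Un_upper2 order_refl]
    by (simp add: hom sum.distrib)
  show "bilin_ext \<mu> C (A + B) = bilin_ext \<mu> C A + bilin_ext \<mu> C B"
    using bilin_ext_eq[OF assms(3) AB fin(2,1) order_refl sub]
      bilin_ext_eq[OF assms(3,1) fin(2,1) order_refl Un_upper1]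
      bilin_ext_eq[OF assms(3,2) fin(2,1) order_refl Un_upper2]
    by (simp add: hom sum.distrib)
qed

lemma bilin_ext_scale:
  assumes "A \<in> DO_all" "C \<in> DO_all"
  shows "bilin_ext \<mu> (c *\<^sub>D A) C = c *\<^sub>D bilin_ext \<mu> A C"
    and "bilin_ext \<mu> C (c *\<^sub>D A) = c *\<^sub>D bilin_ext \<mu> C A"
proof -
  let ?c = "component DO_family"
  let ?K = "{k. ?c A k \<noteq> 0}" and ?L = "{k. ?c C k \<noteq> 0}"
  have fin: "finite ?K" "finite ?L" using assms finite_component_DO by auto
  have sub: "{k. ?c (c *\<^sub>D A) k \<noteq> 0} \<subseteq> ?K" using assms by (auto simp: component_DO_scale)
  note cA = scale_mem_DO_all[OF assms(1), of c]
  have hom: "\<mu>c (c *\<^sub>D A) C k l = c *\<^sub>D \<mu>c A C k l"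
    "\<mu>c C (c *\<^sub>D A) k l = c *\<^sub>D \<mu>c C A k l" for k l
    using \<mu> assms[THEN component_DO_mem', of k] assms[THEN component_DO_mem', of l]
    unfolding bilinear_on_DO_def by (simp_all add: component_DO_scale assms)
  show "bilin_ext \<mu> (c *\<^sub>D A) C = c *\<^sub>D bilin_ext \<mu> A C"
    using bilin_ext_eq[OF cA assms(2) fin sub order_refl]
      bilin_ext_eq[OF assms fin order_refl order_refl]
    by (simp add: hom fun_space.scale_sum_right)
  show "bilin_ext \<mu> C (c *\<^sub>D A) = c *\<^sub>D bilin_ext \<mu> C A"
    using bilin_ext_eq[OF assms(2) cA fin(2,1) order_refl sub]
      bilin_ext_eq[OF assms(2,1) fin(2,1) order_refl order_refl]
    by (simp add: hom fun_space.scale_sum_right)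
qed

end

section \<open>Product and bracket as bilinear operations\<close>

notation sj_product (infixl \<open>\<odot>\<close> 75)
notation sj_bracket (\<open>\<lbrace>_,/ _\<rbrace>\<close>)

lemma sj_product_add [simp]:
  assumes "A \<in> DO_all" "B \<in> DO_all" "C \<in> DO_all"
  shows "(A + B) \<odot> C = A \<odot> C + B \<odot> C" "C \<odot> (A + B) = C \<odot> A + C \<odot> B"
  unfolding sj_product_def using bilin_ext_add[OF bilinear_on_DO_prod_hom assms] .

lemma sj_product_scale [simp]:
  assumes "A \<in> DO_all" "C \<in> DO_all"
  shows "(c *\<^sub>D A) \<odot> C = c *\<^sub>D (A \<odot> C)" "C \<odot> (c *\<^sub>D A) = c *\<^sub>D (C \<odot> A)"
  unfolding sj_product_def using bilin_ext_scale[OF bilinear_on_DO_prod_hom assms] .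

lemma sj_bracket_add [simp]:
  assumes "A \<in> DO_all" "B \<in> DO_all" "C \<in> DO_all"
  shows "\<lbrace>A + B, C\<rbrace> = \<lbrace>A, C\<rbrace> + \<lbrace>B, C\<rbrace>" "\<lbrace>C, A + B\<rbrace> = \<lbrace>C, A\<rbrace> + \<lbrace>C, B\<rbrace>"
  unfolding sj_bracket_def using bilin_ext_add[OF bilinear_on_DO_bracket_hom assms] .

lemma sj_bracket_scale [simp]:
  assumes "A \<in> DO_all" "C \<in> DO_all"
  shows "\<lbrace>c *\<^sub>D A, C\<rbrace> = c *\<^sub>D \<lbrace>A, C\<rbrace>" "\<lbrace>C, c *\<^sub>D A\<rbrace> = c *\<^sub>D \<lbrace>C, A\<rbrace>"
  unfolding sj_bracket_def using bilin_ext_scale[OF bilinear_on_DO_bracket_hom assms] .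

lemma sj_product_minus [simp]:
  assumes "A \<in> DO_all" "C \<in> DO_all"
  shows "(- A) \<odot> C = - (A \<odot> C)" "C \<odot> (- A) = - (C \<odot> A)"
  using sj_product_scale[OF assms, of "- 1"] by simp_all

lemma sj_bracket_minus [simp]:
  assumes "A \<in> DO_all" "C \<in> DO_all"
  shows "\<lbrace>- A, C\<rbrace> = - \<lbrace>A, C\<rbrace>" "\<lbrace>C, - A\<rbrace> = - \<lbrace>C, A\<rbrace>"
  using sj_bracket_scale[OF assms, of "- 1"] by simp_all

lemma sj_product_diff [simp]:
  assumes "A \<in> DO_all" "B \<in> DO_all" "C \<in> DO_all"
  shows "(A - B) \<odot> C = A \<odot> C - B \<odot> C" "C \<odot> (A - B) = C \<odot> A - C \<odot> B"
  using sj_product_add[of A "- B" C] assms by simp_all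

lemma sj_bracket_diff [simp]:
  assumes "A \<in> DO_all" "B \<in> DO_all" "C \<in> DO_all"
  shows "\<lbrace>A - B, C\<rbrace> = \<lbrace>A, C\<rbrace> - \<lbrace>B, C\<rbrace>" "\<lbrace>C, A - B\<rbrace> = \<lbrace>C, A\<rbrace> - \<lbrace>C, B\<rbrace>"
  using sj_bracket_add[of A "- B" C] assms by simp_all

lemma sj_product_zero [simp]: "C \<in> DO_all \<Longrightarrow> 0 \<odot> C = 0" "C \<in> DO_all \<Longrightarrow> C \<odot> 0 = 0"
  using sj_product_scale[of 0 C 0] by simp_all

lemma sj_bracket_zero [simp]: "C \<in> DO_all \<Longrightarrow> \<lbrace>0, C\<rbrace> = 0" "C \<in> DO_all \<Longrightarrow> \<lbrace>C, 0\<rbrace> = 0"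
  using sj_bracket_scale[of 0 C 0] by simp_all

lemma sj_product_hom: "A \<in> DO i p \<Longrightarrow> B \<in> DO j q \<Longrightarrow> A \<odot> B = prod_hom i p j q A B"
  unfolding sj_product_def by (rule bilin_ext_homogeneous[OF bilinear_on_DO_prod_hom])

lemma sj_bracket_hom: "A \<in> DO i p \<Longrightarrow> B \<in> DO j q \<Longrightarrow> \<lbrace>A, B\<rbrace> = bracket_hom i p j q A B"
  unfolding sj_bracket_def by (rule bilin_ext_homogeneous[OF bilinear_on_DO_bracket_hom])

lemma app_mem_DO_all [simp]:
  assumes "A \<in> DO_all"
  shows "A \<bullet> a \<in> DO_all"
  using assms
proof (induction rule: DO_all_induct)
  case (homogeneous i p A)
  show ?case
  proof (cases i)
    case 0
    then have "A \<bullet> a = 0" using homogeneous by auto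
    then show ?thesis by simp
  next
    case (Suc j)
    have "A \<bullet> a = (\<Sum>e | component G a e \<noteq> 0. A \<bullet> component G a e)"
      using homogeneous Suc by (intro first_linear_app) (simp add: first_linear_DO_Suc)
    moreover have "A \<bullet> component G a e \<in> DO_all" for e
      by (rule mem_DO_all[OF app_mem_DO[OF homogeneous component_G_mem]])
    ultimately show ?thesis by (simp add: sum_mem_DO_all)
  qed
qed (simp add: app_add)

lemma lact_mem_DO_all [simp]:
  assumes "A \<in> DO_all"
  shows "lact x A \<in> DO_all"
  using assms
proof (induction rule: DO_all_induct)
  case (homogeneous i p A)
  have "additive (\<lambda>x. lact x A)" by (simp add: additive_def lact_add_left)
  from additive.sum[OF this, of "component G x" "{e. component G x e \<noteq> 0}"]
  have "lact x A = (\<Sum>e | component G x e \<noteq> 0. lact (component G x e) A)"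
    by (simp add: grading.sum_component)
  moreover have "lact (component G x e) A \<in> DO_all" for e
    by (rule mem_DO_all[OF lact_mem_DO[OF homogeneous component_G_mem]])
  ultimately show ?case by (simp add: sum_mem_DO_all)
qed (simp add: lact_add)

lemma app_add_right [simp]: "A \<in> DO_all \<Longrightarrow> A \<bullet> (a + b) = A \<bullet> a + A \<bullet> b"
  and app_scale_right [simp]: "A \<in> DO_all \<Longrightarrow> A \<bullet> (c *\<^sub>k a) = c *\<^sub>D (A \<bullet> a)"
proof -
  have "A \<bullet> (a + b) = A \<bullet> a + A \<bullet> b \<and> A \<bullet> (c *\<^sub>k a) = c *\<^sub>D (A \<bullet> a)" if "A \<in> DO_all"
    using that
  proof (induction rule: DO_all_induct)
    case (homogeneous i p A)
    show ?case
    proof (cases i)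
      case 0
      then show ?thesis using homogeneous by auto
    next
      case (Suc j)
      then show ?thesis using homogeneous first_linear_DO_Suc unfolding first_linear_def by blast
    qed
  qed (simp add: app_add fun_scale_simps)
  then show "A \<in> DO_all \<Longrightarrow> A \<bullet> (a + b) = A \<bullet> a + A \<bullet> b"
    and "A \<in> DO_all \<Longrightarrow> A \<bullet> (c *\<^sub>k a) = c *\<^sub>D (A \<bullet> a)" by auto
qed

end

section \<open>Evaluation identities\<close>

context schouten_jacobi
begin

text \<open>
  Zero spaces in negative genus make evaluation map \<open>homog u\<close> to
  \<open>homog (u + (|a|, 0) - (\<alpha>, 1))\<close> for every \<open>u\<close>, so that no identity below needs
  a special case for genus 0.
\<close>

definition homog :: "(int ^ 'n) \<times> int \<Rightarrow> ('a list \<Rightarrow> 'a) set" where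
  "homog u = (if snd u < 0 then {0} else DO (nat (snd u)) (fst u - snd u *s \<alpha>))"

lemma homog_total_deg [simp]: "homog (total_deg i d) = DO i d"
  by (simp add: homog_def total_deg_def)

lemma homog_cases [consumes 1, case_names negative DO]:
  assumes "A \<in> homog u"
  obtains "snd u < 0" "A = 0" | i d where "u = total_deg i d" "A \<in> DO i d"
proof (cases "snd u < 0")
  case False
  then have "u = total_deg (nat (snd u)) (fst u - snd u *s \<alpha>)"
    by (simp add: total_deg_def prod_eq_iff)
  with assms that(2) show thesis by (metis homog_total_deg)
qed (use assms that(1) in \<open>simp add: homog_def\<close>)

lemma homog_mem_DO_all: "A \<in> homog u \<Longrightarrow> A \<in> DO_all"
  by (erule homog_cases) (simp_all add: mem_DO_all)

lemma zero_mem_homog [simp]: "0 \<in> homog u"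
  by (simp add: homog_def zero_mem_DO)

lemma add_mem_homog: "A \<in> homog u \<Longrightarrow> B \<in> homog u \<Longrightarrow> A + B \<in> homog u"
  by (auto simp: homog_def add_mem_DO split: if_splits)

lemma scale_mem_homog: "A \<in> homog u \<Longrightarrow> c *\<^sub>D A \<in> homog u"
  by (auto simp: homog_def scale_mem_DO split: if_splits)

lemma minus_mem_homog: "A \<in> homog u \<Longrightarrow> - A \<in> homog u"
  using scale_mem_homog[of A u "- 1"] by simp

lemma of_alg_mem_homog: "x \<in> G c \<Longrightarrow> of_alg x \<in> homog (alg_deg c)"
  using homog_total_deg[of 0 c] by (simp add: total_deg_zero)

lemma homog_genus_zero:
  assumes "A \<in> homog u" "snd u = 0"
  obtains x where "A = of_alg x" "x \<in> G (fst u)" "u = alg_deg (fst u)"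
  using assms(1)
proof (cases rule: homog_cases)
  case (DO i d)
  then have "i = 0" using assms(2) by simp
  with DO that show ?thesis by (auto simp: total_deg_def alg_deg_def)
qed (use assms in simp)

lemma homog_app:
  assumes "A \<in> homog u" "a \<in> G e"
  shows "A \<bullet> a \<in> homog (u + alg_deg e - \<omega>)"
  using assms(1)
proof (cases rule: homog_cases)
  case (DO i d)
  show ?thesis
  proof (cases i)
    case 0
    then have "A \<bullet> a = 0" using DO by auto
    then show ?thesis by simp
  next
    case (Suc j)
    then have "u + alg_deg e - \<omega> = total_deg j (d + e)"
      using DO by (simp add: total_deg_add total_deg_Suc)
    then show ?thesis using DO Suc assms(2) by (simp add: DO_Suc_app)
  qed
qed simp

lemma homog_lact:
  assumes "A \<in> homog u" "x \<in> G c"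
  shows "lact x A \<in> homog (u + alg_deg c)"
  using assms(1)
proof (cases rule: homog_cases)
  case (DO i d)
  have "u + alg_deg c = total_deg i (c + d)"
    using DO total_deg_add[of i d c] by (simp add: add.commute)
  then show ?thesis using lact_mem_DO[OF DO(2) assms(2)] by simp
qed simp

lemma homog_app_mult:
  assumes "A \<in> homog u" "a \<in> G e" "b \<in> G f"
  shows "A \<bullet> (a * b) =
      deg_sign (alg_deg f) (u + alg_deg e - \<omega>) *\<^sub>D lact b (A \<bullet> a)
    + deg_sign (alg_deg e) (u - \<omega>) *\<^sub>D lact a (A \<bullet> b)
    - deg_sign (alg_deg e + alg_deg f) (u - \<omega>) *\<^sub>D lact (a * b) (A \<bullet> 1)"
  using assms(1)
proof (cases rule: homog_cases)
  case (DO i d)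
  show ?thesis
  proof (cases i)
    case 0
    then have "A \<bullet> x = 0" for x using DO by auto
    then show ?thesis by simp
  next
    case (Suc j)
    show ?thesis
      using DO_Suc_app_mult[OF DO(2)[unfolded Suc] assms(2,3)] DO(1)
      by (simp add: Suc total_deg_Suc)
  qed
qed simp

text \<open>Antisymmetry is imposed by definition from genus 2 on; in lower genus both double
  evaluations are 0.\<close>

lemma homog_app_app:
  assumes "A \<in> homog u" "a \<in> G e" "b \<in> G f"
  shows "A \<bullet> a \<bullet> b = deg_sign (alg_deg e - \<omega>) (alg_deg f - \<omega>) *\<^sub>D (A \<bullet> b \<bullet> a)"
  using assms(1)
proof (cases rule: homog_cases)
  case (DO i d)
  consider "i = 0" | "i = 1" | j where "i = Suc (Suc j)" by (metis One_nat_def not0_implies_Suc)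
  then show ?thesis
  proof cases
    case 1
    then have "A \<bullet> x = 0" for x using DO by auto
    then show ?thesis by simp
  next
    case 2
    then have "A \<bullet> a \<in> DO 0 (d + e)" "A \<bullet> b \<in> DO 0 (d + f)"
      using DO DO_Suc_app assms by (simp_all only: One_nat_def)
    then have "A \<bullet> a \<bullet> b = 0" "A \<bullet> b \<bullet> a = 0" by auto
    then show ?thesis by simp
  next
    case 3
    then show ?thesis using DO_Suc_app_app[OF _ _ assms(2,3)] DO(2) by blast
  qed
qed simp

lemma homog_first_linear:
  assumes "A \<in> homog u" "snd u \<ge> 1"
  shows "first_linear A"
  using assms(1)
proof (cases rule: homog_cases)
  case (DO i d)
  then obtain j where "i = Suc j" using assms(2) by (cases i) auto
  with DO(2) have "A \<in> DO (Suc j) d" by (simp only:)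
  then show ?thesis by (rule first_linear_DO_Suc)
qed (use assms(2) in simp)

text \<open>The tool behind the later inductions. The bound on the genus cannot be dropped: distinct
  elements of the algebra have the same, vanishing, evaluations.\<close>

lemma homog_eqI:
  assumes "A \<in> homog u" "B \<in> homog u" "snd u \<ge> 1" "\<And>e a. a \<in> G e \<Longrightarrow> A \<bullet> a = B \<bullet> a"
  shows "A = B"
  by (rule first_linear_eqI[OF homog_first_linear[OF assms(1,3)] homog_first_linear[OF assms(2,3)]
        assms(4)])

lemma homogI:
  assumes "snd u \<ge> 1" "first_linear D"
    and "\<And>e a. a \<in> G e \<Longrightarrow> D \<bullet> a \<in> homog (u + alg_deg e - \<omega>)"
    and "\<And>e f a b. a \<in> G e \<Longrightarrow> b \<in> G f \<Longrightarrow> D \<bullet> (a * b) =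
      deg_sign (alg_deg f) (u + alg_deg e - \<omega>) *\<^sub>D lact b (D \<bullet> a)
    + deg_sign (alg_deg e) (u - \<omega>) *\<^sub>D lact a (D \<bullet> b)
    - deg_sign (alg_deg e + alg_deg f) (u - \<omega>) *\<^sub>D lact (a * b) (D \<bullet> 1)"
    and "\<And>e f a b. a \<in> G e \<Longrightarrow> b \<in> G f \<Longrightarrow>
      D \<bullet> a \<bullet> b = deg_sign (alg_deg e - \<omega>) (alg_deg f - \<omega>) *\<^sub>D (D \<bullet> b \<bullet> a)"
  shows "D \<in> homog u"
proof -
  define i d where "i = nat (snd u - 1)" and "d = fst u - snd u *s \<alpha>"
  have u: "u = total_deg (Suc i) d"
    using assms(1) by (simp add: total_deg_def prod_eq_iff i_def d_def)
  have eqs: "u + alg_deg e - \<omega> = total_deg i d + alg_deg e" "u - \<omega> = total_deg i d" for e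
    by (simp_all add: u total_deg_Suc)
  have "D \<in> DO (Suc i) d"
    unfolding DO_Suc_iff
  proof (intro conjI allI ballI impI)
    show "D \<bullet> a \<in> DO i (d + e)" if "a \<in> G e" for a e
      using assms(3)[OF that] unfolding eqs total_deg_add[symmetric] homog_total_deg .
    fix e f a b assume ab: "a \<in> G e" "b \<in> G f"
    show "D \<bullet> (a * b) =
          deg_sign (alg_deg f) (total_deg i d + alg_deg e) *\<^sub>D lact b (D \<bullet> a)
        + deg_sign (alg_deg e) (total_deg i d) *\<^sub>D lact a (D \<bullet> b)
        - deg_sign (alg_deg e + alg_deg f) (total_deg i d) *\<^sub>D lact (a * b) (D \<bullet> 1)"
      using assms(4)[OF ab] unfolding eqs .
    show "D \<bullet> a \<bullet> b = deg_sign (alg_deg e - \<omega>) (alg_deg f - \<omega>) *\<^sub>D (D \<bullet> b \<bullet> a)"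
      by (rule assms(5)[OF ab])
  qed (rule assms(2))
  then show ?thesis by (simp add: u)
qed

section \<open>Symmetry and multiplication by algebra elements\<close>

lemma sj_product_commute:
  assumes "A \<in> homog u" "B \<in> homog v"
  shows "A \<odot> B = deg_sign u v *\<^sub>D (B \<odot> A)"
proof -
  note mem = assms[THEN homog_mem_DO_all]
  show ?thesis
    using assms(1)
  proof (cases rule: homog_cases)
    case A: (DO i p)
    from assms(2) show ?thesis
    proof (cases rule: homog_cases)
      case B: (DO j q)
      show ?thesis
        unfolding sj_product_hom[OF A(2) B(2)] sj_product_hom[OF B(2) A(2)] A(1) B(1)
        by (rule prod_hom_commute[OF A(2) B(2)])
    qed (use mem in simp)
  qed (use mem in simp)
qed

lemma sj_bracket_commute:
  assumes "A \<in> homog u" "B \<in> homog v"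
  shows "\<lbrace>A, B\<rbrace> = - (deg_sign (u - \<omega>) (v - \<omega>) *\<^sub>D \<lbrace>B, A\<rbrace>)"
proof -
  note mem = assms[THEN homog_mem_DO_all]
  show ?thesis
    using assms(1)
  proof (cases rule: homog_cases)
    case A: (DO i p)
    from assms(2) show ?thesis
    proof (cases rule: homog_cases)
      case B: (DO j q)
      show ?thesis
        unfolding sj_bracket_hom[OF A(2) B(2)] sj_bracket_hom[OF B(2) A(2)] A(1) B(1)
        by (rule bracket_hom_commute[OF A(2) B(2)])
    qed (use mem in simp)
  qed (use mem in simp)
qed

lemma sj_product_of_alg:
  assumes "x \<in> G c" "B \<in> homog v"
  shows "of_alg x \<odot> B = lact x B"
  using assms(2)
proof (cases rule: homog_cases)
  case (DO j q)
  have "of_alg x \<in> DO 0 c" using assms(1) by simp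
  from sj_product_hom[OF this DO(2)] show ?thesis by simp
qed (simp add: homog_mem_DO_all[OF of_alg_mem_homog[OF assms(1)]])

lemma sj_bracket_of_alg:
  assumes "A \<in> homog u" "b \<in> G f"
  shows "\<lbrace>A, of_alg b\<rbrace> = A \<bullet> b"
  using assms(1)
proof (cases rule: homog_cases)
  case (DO i p)
  have "of_alg b \<in> DO 0 f" using assms(2) by simp
  from sj_bracket_hom[OF DO(2) this] DO show ?thesis by (cases i) auto
qed (simp add: homog_mem_DO_all[OF of_alg_mem_homog[OF assms(2)]])

lemma sj_product_lact_left:
  assumes "A \<in> homog u" "B \<in> homog v" "x \<in> G c"
  shows "lact x A \<odot> B = lact x (A \<odot> B)"
  using assms(1)
proof (cases rule: homog_cases)
  case A: (DO i p)
  from assms(2) show ?thesis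
  proof (cases rule: homog_cases)
    case B: (DO j q)
    show ?thesis
      using sj_product_hom[OF lact_mem_DO[OF A(2) assms(3)] B(2)]
        sj_product_hom[OF A(2) B(2)] prod_hom_lact[OF assms(3) A(2) B(2)] by simp
  qed (use A mem_DO_all in simp)
qed (use assms homog_mem_DO_all in simp)

text \<open>Commute, pull x out on the left, commute back: the signs between A and B cancel and only
  that of A passing x remains.\<close>

lemma sj_product_lact_right:
  assumes "A \<in> homog u" "B \<in> homog v" "x \<in> G c"
  shows "A \<odot> lact x B = deg_sign u (alg_deg c) *\<^sub>D lact x (A \<odot> B)"
proof -
  have "A \<odot> lact x B = deg_sign u (v + alg_deg c) *\<^sub>D lact x (B \<odot> A)"
    using sj_product_commute[OF assms(1) homog_lact[OF assms(2,3)]]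
      sj_product_lact_left[OF assms(2,1,3)] by simp
  also have "B \<odot> A = deg_sign v u *\<^sub>D (A \<odot> B)"
    by (rule sj_product_commute[OF assms(2,1)])
  finally have "A \<odot> lact x B =
      (deg_sign u (v + alg_deg c) * deg_sign v u) *\<^sub>D lact x (A \<odot> B)"
    by (simp only: lact_scale fun_space.scale_scale)
  also have "deg_sign u (v + alg_deg c) * deg_sign v u = deg_sign u (alg_deg c)"
    by (simp add: deg_sign_add_right deg_sign_commute[of v u] mult_ac)
  finally show ?thesis .
qed

section \<open>Evaluation as a graded derivation\<close>

lemma prod_hom_Suc_Suc_linear:
  assumes "A \<in> DO (Suc i) p" "B \<in> DO (Suc j) q"
  shows "first_linear (prod_hom (Suc i) p (Suc j) q A B)"
    and "a \<in> G e \<Longrightarrow> prod_hom (Suc i) p (Suc j) q A B \<bullet> a =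
      deg_sign (alg_deg e - \<omega>) (total_deg (Suc j) q) *\<^sub>D prod_hom i (p + e) (Suc j) q (A \<bullet> a) B
      + prod_hom (Suc i) p j (q + e) A (B \<bullet> a)"
proof -
  note mem = assms[THEN mem_DO_all]
  have 0: "prod_hom i p j q 0 B = 0" "prod_hom i p j q A 0 = 0" for i p j q A B
    using prod_hom_scale_left[of i p j q 0 0 B] prod_hom_scale_right[of i p j q A 0 0]
    by (simp_all only: fun_space.scale_zero_left)
  have "A \<bullet> 0 = 0" "B \<bullet> 0 = 0"
    using assms[THEN first_linear_DO_Suc] by simp_all
  then show "a \<in> G e \<Longrightarrow> prod_hom (Suc i) p (Suc j) q A B \<bullet> a =
      deg_sign (alg_deg e - \<omega>) (total_deg (Suc j) q) *\<^sub>D prod_hom i (p + e) (Suc j) q (A \<bullet> a) B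
      + prod_hom (Suc i) p j (q + e) A (B \<bullet> a)"
    unfolding prod_hom_Suc_Suc by (subst lin_ext_homogeneous) (simp_all add: 0)
  show "first_linear (prod_hom (Suc i) p (Suc j) q A B)"
    unfolding prod_hom_Suc_Suc
    by (rule first_linear_lin_ext)
      (simp_all add: mem prod_hom_add_left prod_hom_add_right prod_hom_scale_left
        prod_hom_scale_right fun_scale_simps mult.commute)
qed

lemma bracket_hom_Suc_Suc_linear:
  assumes "A \<in> DO (Suc i) p" "B \<in> DO (Suc j) q"
  shows "first_linear (bracket_hom (Suc i) p (Suc j) q A B)"
    and "a \<in> G e \<Longrightarrow> bracket_hom (Suc i) p (Suc j) q A B \<bullet> a =
      deg_sign (alg_deg e - \<omega>) (total_deg j q) *\<^sub>D bracket_hom i (p + e) (Suc j) q (A \<bullet> a) B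
      + bracket_hom (Suc i) p j (q + e) A (B \<bullet> a)"
proof -
  note mem = assms[THEN mem_DO_all] and app = DO_Suc_app[OF assms(1)] DO_Suc_app[OF assms(2)]
  have 0: "bracket_hom i (p + e) (Suc j) q 0 B = 0" "bracket_hom (Suc i) p j (q + e) A 0 = 0" for e
    using bilinear_zero[OF bilinear_on_DO_bracket_hom assms(2)]
      bilinear_zero[OF bilinear_on_DO_bracket_hom assms(1)] by blast+
  have "A \<bullet> 0 = 0" "B \<bullet> 0 = 0"
    using assms[THEN first_linear_DO_Suc] by simp_all
  then show "a \<in> G e \<Longrightarrow> bracket_hom (Suc i) p (Suc j) q A B \<bullet> a =
      deg_sign (alg_deg e - \<omega>) (total_deg j q) *\<^sub>D bracket_hom i (p + e) (Suc j) q (A \<bullet> a) B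
      + bracket_hom (Suc i) p j (q + e) A (B \<bullet> a)"
    unfolding bracket_hom_Suc_Suc by (subst lin_ext_homogeneous) (simp_all add: 0)
  show "first_linear (bracket_hom (Suc i) p (Suc j) q A B)"
    unfolding bracket_hom_Suc_Suc
  proof (rule first_linear_lin_ext)
    fix e a b c assume "a \<in> G e"
    note [simp] = app[OF this] mem assms
    show "deg_sign (alg_deg e - \<omega>) (total_deg j q) *\<^sub>D
          bracket_hom i (p + e) (Suc j) q (A \<bullet> (c *\<^sub>k a)) B
        + bracket_hom (Suc i) p j (q + e) A (B \<bullet> (c *\<^sub>k a))
      = c *\<^sub>D (deg_sign (alg_deg e - \<omega>) (total_deg j q) *\<^sub>D
          bracket_hom i (p + e) (Suc j) q (A \<bullet> a) B
        + bracket_hom (Suc i) p j (q + e) A (B \<bullet> a))"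
      by (simp add: bracket_hom_scale_left bracket_hom_scale_right fun_scale_simps mult.commute)
    assume "b \<in> G e"
    note [simp] = app[OF this]
    show "deg_sign (alg_deg e - \<omega>) (total_deg j q) *\<^sub>D
          bracket_hom i (p + e) (Suc j) q (A \<bullet> (a + b)) B
        + bracket_hom (Suc i) p j (q + e) A (B \<bullet> (a + b))
      = deg_sign (alg_deg e - \<omega>) (total_deg j q) *\<^sub>D
          bracket_hom i (p + e) (Suc j) q (A \<bullet> a) B
        + bracket_hom (Suc i) p j (q + e) A (B \<bullet> a)
        + (deg_sign (alg_deg e - \<omega>) (total_deg j q) *\<^sub>D
          bracket_hom i (p + e) (Suc j) q (A \<bullet> b) B
        + bracket_hom (Suc i) p j (q + e) A (B \<bullet> b))"
      by (simp add: bracket_hom_add_left bracket_hom_add_right fun_scale_simps)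
  qed
qed

text \<open>In positive genera this is the recursion itself. The content lies in the mixed cases,
  where the product is a module action and evaluation commutes with \<open>lact\<close>.\<close>

lemma sj_product_app:
  assumes "A \<in> homog u" "B \<in> homog v" "a \<in> G e"
  shows "(A \<odot> B) \<bullet> a =
    deg_sign (alg_deg e - \<omega>) v *\<^sub>D ((A \<bullet> a) \<odot> B) + A \<odot> (B \<bullet> a)"
proof -
  note mem = assms(1,2)[THEN homog_mem_DO_all]
  have genus_zero: "(A \<odot> B) \<bullet> a = A \<odot> (B \<bullet> a)" "A \<bullet> a = 0"
    if hom: "A \<in> homog u" "B \<in> homog v" "snd u = 0" for A B u v
  proof -
    obtain x where x: "A = of_alg x" "x \<in> G (fst u)"
      using hom(1,3) by (rule homog_genus_zero)
    then show "(A \<odot> B) \<bullet> a = A \<odot> (B \<bullet> a)" "A \<bullet> a = 0"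
      using sj_product_of_alg[OF x(2)] hom(2) homog_app[OF hom(2) assms(3)]
      by (simp_all add: app_lact)
  qed
  show ?thesis
    using assms(1)
  proof (cases rule: homog_cases)
    case A: (DO i p)
    from assms(2) show ?thesis
    proof (cases rule: homog_cases)
      case B: (DO j q)
      consider "i = 0" | "j = 0" | k l where "i = Suc k" "j = Suc l" by (metis not0_implies_Suc)
      then show ?thesis
      proof cases
        case 1
        then show ?thesis using genus_zero[OF assms(1,2)] A mem by simp
      next
        case 2
        \<comment> \<open>The factor of genus 0 is commuted to the left, where
          \<open>genus_zero\<close> applies; the next step commutes back.\<close>
        have "(A \<odot> B) \<bullet> a = deg_sign u v *\<^sub>D (B \<odot> (A \<bullet> a))"
          unfolding sj_product_commute[OF assms(1,2)] app_scale
          using genus_zero[OF assms(2,1)] B 2 by simp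
        also have "\<dots> = deg_sign (alg_deg e - \<omega>) v *\<^sub>D ((A \<bullet> a) \<odot> B)"
          using sj_product_commute[OF homog_app[OF assms(1,3)] assms(2)]
          by (simp add: deg_sign_simps mult_ac)
        finally show ?thesis using genus_zero[OF assms(2,1)] B 2 mem by simp
      next
        case 3
        show ?thesis
          using prod_hom_Suc_Suc_linear(2)[OF A(2)[unfolded 3] B(2)[unfolded 3] assms(3)]
            sj_product_hom[OF A(2) B(2)] sj_product_hom[OF _ B(2)] sj_product_hom[OF A(2)]
            DO_Suc_app[OF A(2)[unfolded 3] assms(3)] DO_Suc_app[OF B(2)[unfolded 3] assms(3)]
          by (simp add: 3 B(1))
      qed
    qed (use mem in simp)
  qed (use mem in simp)
qed

text \<open>When B is an element x of the algebra, this says that A(x, a) and A(a, x) agree up to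
  sign, so it is the antisymmetry condition on operators that makes evaluation a derivation
  here.\<close>

lemma sj_bracket_app:
  assumes "A \<in> homog u" "B \<in> homog v" "a \<in> G e"
  shows "\<lbrace>A, B\<rbrace> \<bullet> a =
    deg_sign (alg_deg e - \<omega>) (v - \<omega>) *\<^sub>D \<lbrace>A \<bullet> a, B\<rbrace> + \<lbrace>A, B \<bullet> a\<rbrace>"
proof -
  note mem = assms(1,2)[THEN homog_mem_DO_all]
  have genus_zero: "\<lbrace>A, B\<rbrace> \<bullet> a = deg_sign (alg_deg e - \<omega>) (v - \<omega>) *\<^sub>D \<lbrace>A \<bullet> a, B\<rbrace>" "B \<bullet> a = 0"
    if hom: "A \<in> homog u" "B \<in> homog v" "snd v = 0" for A B u v
  proof -
    obtain x where x: "B = of_alg x" "x \<in> G (fst v)" "v = alg_deg (fst v)"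
      using hom(2,3) by (rule homog_genus_zero)
    have "A \<bullet> x \<bullet> a = deg_sign (v - \<omega>) (alg_deg e - \<omega>) *\<^sub>D (A \<bullet> a \<bullet> x)"
      using homog_app_app[OF hom(1) x(2) assms(3)] x(3) by simp
    then show "\<lbrace>A, B\<rbrace> \<bullet> a = deg_sign (alg_deg e - \<omega>) (v - \<omega>) *\<^sub>D \<lbrace>A \<bullet> a, B\<rbrace>" "B \<bullet> a = 0"
      using sj_bracket_of_alg[OF _ x(2)] hom(1) homog_app[OF hom(1) assms(3)]
      by (simp_all add: x(1) deg_sign_commute[of "v - \<omega>"])
  qed
  show ?thesis
    using assms(1)
  proof (cases rule: homog_cases)
    case A: (DO i p)
    from assms(2) show ?thesis
    proof (cases rule: homog_cases)
      case B: (DO j q)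
      consider "i = 0" | "j = 0" | k l where "i = Suc k" "j = Suc l" by (metis not0_implies_Suc)
      then show ?thesis
      proof cases
        case 1
        have "\<lbrace>A, B\<rbrace> \<bullet> a = - (deg_sign (u - \<omega>) (v - \<omega>) *\<^sub>D
            (deg_sign (alg_deg e - \<omega>) (u - \<omega>) *\<^sub>D \<lbrace>B \<bullet> a, A\<rbrace>))"
          unfolding sj_bracket_commute[OF assms(1,2)] app_scale app_minus
          using genus_zero[OF assms(2,1)] A 1 by simp
        also have "\<dots> = \<lbrace>A, B \<bullet> a\<rbrace>"
          using sj_bracket_commute[OF assms(1) homog_app[OF assms(2,3)]]
          by (simp add: deg_sign_simps deg_sign_commute mult_ac)
        finally show ?thesis using genus_zero[OF assms(2,1)] A 1 mem by simp
      next
        case 2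
        then show ?thesis using genus_zero[OF assms(1,2)] B mem by simp
      next
        case 3
        show ?thesis
          using bracket_hom_Suc_Suc_linear(2)[OF A(2)[unfolded 3] B(2)[unfolded 3] assms(3)]
            sj_bracket_hom[OF A(2) B(2)] sj_bracket_hom[OF _ B(2)] sj_bracket_hom[OF A(2)]
            DO_Suc_app[OF A(2)[unfolded 3] assms(3)] DO_Suc_app[OF B(2)[unfolded 3] assms(3)]
          by (simp add: 3 B(1) total_deg_Suc)
      qed
    qed (use mem in simp)
  qed (use mem in simp)
qed

lemma sj_product_first_linear:
  assumes "A \<in> homog u" "B \<in> homog v" "snd u + snd v \<ge> 1"
  shows "first_linear (A \<odot> B)"
  using assms(1)
proof (cases rule: homog_cases)
  case A: (DO i p)
  from assms(2) show ?thesis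
  proof (cases rule: homog_cases)
    case B: (DO j q)
    have "first_linear (prod_hom i p j q A B)"
    proof (cases i)
      case 0
      then obtain k where k: "j = Suc k" using assms(3) A(1) B(1) by (cases j) auto
      show ?thesis
        using first_linear_DO_Suc[OF B(2)[unfolded k]] by (simp add: 0 first_linear_lact)
    next
      case (Suc k)
      note A' = A(2)[unfolded Suc]
      show ?thesis
      proof (cases j)
        case 0
        then show ?thesis
          using first_linear_DO_Suc[OF A']
          by (simp add: Suc prod_hom_Suc_0 first_linear_scale first_linear_lact)
      next
        case (Suc l)
        then show ?thesis
          using prod_hom_Suc_Suc_linear(1)[OF A' B(2)[unfolded Suc]] \<open>i = Suc k\<close>
          by (simp only:)
      qed
    qed
    then show ?thesis by (simp add: sj_product_hom[OF A(2) B(2)])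
  qed (use assms homog_mem_DO_all first_linear_zero in simp)
qed (use assms homog_mem_DO_all first_linear_zero in simp)

text \<open>Makes brackets comparable by evaluation before they are known to be operators. The
  bracket lowers total genus by 1, hence the bound 2 where the product has 1.\<close>

lemma sj_bracket_first_linear:
  assumes "A \<in> homog u" "B \<in> homog v" "snd u + snd v \<ge> 2"
  shows "first_linear \<lbrace>A, B\<rbrace>"
proof -
  have genus_zero: "first_linear \<lbrace>A, B\<rbrace>"
    if hom: "A \<in> homog u" "B \<in> homog v" "snd u \<ge> 2" "snd v = 0" for A B u v
  proof -
    obtain x where x: "B = of_alg x" "x \<in> G (fst v)"
      using hom(2,4) by (rule homog_genus_zero)
    have "first_linear (A \<bullet> x)"
      by (rule homog_first_linear[OF homog_app[OF hom(1) x(2)]]) (use hom in simp)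
    then show ?thesis using sj_bracket_of_alg[OF hom(1) x(2)] x(1) by simp
  qed
  show ?thesis
    using assms(1)
  proof (cases rule: homog_cases)
    case A: (DO i p)
    from assms(2) show ?thesis
    proof (cases rule: homog_cases)
      case B: (DO j q)
      consider "i = 0" | "j = 0" | k l where "i = Suc k" "j = Suc l" by (metis not0_implies_Suc)
      then show ?thesis
      proof cases
        case 1
        then have "first_linear \<lbrace>B, A\<rbrace>" using genus_zero[OF assms(2,1)] assms(3) A by simp
        then show ?thesis
          by (simp add: sj_bracket_commute[OF assms(1,2)] first_linear_minus first_linear_scale)
      next
        case 2
        then show ?thesis using genus_zero[OF assms(1,2)] assms(3) B by simp
      next
        case 3
        show ?thesis
          using bracket_hom_Suc_Suc_linear(1)[OF A(2)[unfolded 3] B(2)[unfolded 3]]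
          unfolding sj_bracket_hom[OF A(2) B(2)] 3 .
      qed
    qed (use assms homog_mem_DO_all first_linear_zero in simp)
  qed (use assms homog_mem_DO_all first_linear_zero in simp)
qed

section \<open>Products and brackets of operators are operators\<close>

lemma homog_negative: "A \<in> homog u \<Longrightarrow> snd u < 0 \<Longrightarrow> A = 0"
  by (simp add: homog_def)

lemma deg_sign_minus [simp]: "deg_sign u (- v) = deg_sign u v" "deg_sign (- u) v = deg_sign u v"
  using deg_sign_diff_right[of u 0 v] deg_sign_diff_left[of 0 u v] by simp_all

text \<open>Normal form for signs: bilinearity splits them into signs of basic bidegrees, sorting
  brings equal factors together, and \<open>deg_sign_square\<close> cancels them.\<close>

lemmas sign_norm = deg_sign_simps fun_scale_simps lact_add lact_diff lact_minus lact_scale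
  alg_deg_add mult_ac deg_sign_commute

text \<open>Evaluations of the product are combinations of products of smaller total genus. The
  first order condition passes to the product because a multiplier can be pulled out of either
  factor.\<close>

lemma sj_product_mem:
  assumes "A \<in> homog u" "B \<in> homog v"
  shows "A \<odot> B \<in> homog (u + v)"
  using assms
proof (induction "nat (snd u + snd v)" arbitrary: u v A B rule: less_induct)
  case less
  note A = less.prems(1) and B = less.prems(2)
  note mem [simp] = A[THEN homog_mem_DO_all] B[THEN homog_mem_DO_all]
  consider "snd u < 0" | "snd v < 0" | "snd u = 0" "snd v = 0"
    | "snd u \<ge> 0" "snd v \<ge> 0" "snd u + snd v \<ge> 1" by linarith
  then show ?case
  proof cases
    case 1
    then show ?thesis using homog_negative[OF A] by simp
  next
    case 2
    then show ?thesis using homog_negative[OF B] by simp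
  next
    case 3
    from A 3(1) obtain x where x: "A = of_alg x" "x \<in> G (fst u)" "u = alg_deg (fst u)"
      by (rule homog_genus_zero)
    show ?thesis
      using homog_lact[OF B x(2)] sj_product_of_alg[OF x(2) B] x by (simp add: add.commute)
  next
    case 4
    let ?D = "A \<odot> B"
    have app_left: "A \<bullet> a \<odot> B \<in> homog (u + v + alg_deg e - \<omega>)" if "a \<in> G e" for a e
      using less.hyps[OF _ homog_app[OF A that] B] 4 by (simp add: algebra_simps)
    have app_right: "A \<odot> (B \<bullet> a) \<in> homog (u + v + alg_deg e - \<omega>)" if "a \<in> G e" for a e
      using less.hyps[OF _ A homog_app[OF B that]] 4 by (simp add: algebra_simps)
    show ?thesis
    proof (rule homogI)
      show "snd (u + v) \<ge> 1" using 4 by simp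
      show "first_linear ?D" by (rule sj_product_first_linear[OF A B 4(3)])
      show "?D \<bullet> a \<in> homog (u + v + alg_deg e - \<omega>)" if "a \<in> G e" for a e
        unfolding sj_product_app[OF A B that]
        by (intro add_mem_homog scale_mem_homog app_left app_right that)
      fix e f a b assume a: "a \<in> G e" and b: "b \<in> G f"
      note Aa = homog_app[OF A a] homog_app[OF A b] homog_app[OF A one_G]
        and Ba = homog_app[OF B a] homog_app[OF B b] homog_app[OF B one_G]
      note ab = mult_G[OF a b]
      show "?D \<bullet> (a * b) =
          deg_sign (alg_deg f) (u + v + alg_deg e - \<omega>) *\<^sub>D lact b (?D \<bullet> a)
        + deg_sign (alg_deg e) (u + v - \<omega>) *\<^sub>D lact a (?D \<bullet> b)
        - deg_sign (alg_deg e + alg_deg f) (u + v - \<omega>) *\<^sub>D lact (a * b) (?D \<bullet> 1)"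
        unfolding sj_product_app[OF A B ab] homog_app_mult[OF A a b] homog_app_mult[OF B a b]
          sj_product_app[OF A B a] sj_product_app[OF A B b] sj_product_app[OF A B one_G]
        by (simp add: sj_product_lact_left[OF Aa(1) B b] sj_product_lact_left[OF Aa(2) B a]
            sj_product_lact_left[OF Aa(3) B ab] sj_product_lact_right[OF A Ba(1) b]
            sj_product_lact_right[OF A Ba(2) a] sj_product_lact_right[OF A Ba(3) ab] sign_norm)
      show "?D \<bullet> a \<bullet> b = deg_sign (alg_deg e - \<omega>) (alg_deg f - \<omega>) *\<^sub>D (?D \<bullet> b \<bullet> a)"
        unfolding sj_product_app[OF A B a] sj_product_app[OF A B b] app_add app_scale
          sj_product_app[OF Aa(1) B b] sj_product_app[OF Aa(2) B a]
          sj_product_app[OF A Ba(1) b] sj_product_app[OF A Ba(2) a]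
          homog_app_app[OF A a b] homog_app_app[OF B a b]
        by (simp add: sign_norm)
    qed
  qed
qed

text \<open>Both sides are compared by \<open>first_linear_eqI\<close>, which does not presuppose
  that the bracket is an operator. For A in the algebra the claim reduces to evaluation commuting
  with \<open>lact\<close>.\<close>

lemma sj_bracket_lact_right:
  assumes "A \<in> homog u" "B \<in> homog v" "y \<in> G c"
  shows "\<lbrace>A, lact y B\<rbrace> = (A \<bullet> y) \<odot> B + deg_sign (u - \<omega>) (alg_deg c) *\<^sub>D lact y \<lbrace>A, B\<rbrace>
    - deg_sign (u - \<omega>) (alg_deg c) *\<^sub>D lact y ((A \<bullet> 1) \<odot> B)"
  using assms
proof (induction "nat (snd u + snd v)" arbitrary: u v A B rule: less_induct)
  case less
  note A = less.prems(1) and B = less.prems(2) and y = less.prems(3)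
  note mem [simp] = A[THEN homog_mem_DO_all] B[THEN homog_mem_DO_all]
  consider "snd u < 0" | "snd v < 0" | "snd u = 0" | "snd u = 1" "snd v = 0"
    | "snd u + snd v \<ge> 2" "snd u \<ge> 1" "snd v \<ge> 0" by linarith
  then show ?case
  proof cases
    case 1
    then show ?thesis using homog_negative[OF A] by simp
  next
    case 2
    then show ?thesis using homog_negative[OF B] by simp
  next
    case 3
    from A 3 obtain x where x: "A = of_alg x" "x \<in> G (fst u)" "u = alg_deg (fst u)"
      by (rule homog_genus_zero)
    have "\<lbrace>A, C\<rbrace> = - (deg_sign (u - \<omega>) (w - \<omega>) *\<^sub>D (C \<bullet> x))" if "C \<in> homog w" for C w
      using sj_bracket_commute[OF A that] sj_bracket_of_alg[OF that x(2)] x(1) by simp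
    note this[OF B] this[OF homog_lact[OF B y]]
    moreover have "A \<bullet> z = 0" for z using x(1) by simp
    ultimately show ?thesis by (simp add: app_lact sign_norm)
  next
    \<comment> \<open>Both sides lie in the algebra, where evaluation detects nothing; the identity
      is the first order condition on A at the product of y and z.\<close>
    case 4
    from B 4(2) obtain z where z: "B = of_alg z" "z \<in> G (fst v)" "v = alg_deg (fst v)"
      by (rule homog_genus_zero)
    have right: "D \<odot> B = deg_sign w (alg_deg (fst v)) *\<^sub>D lact z D" if "D \<in> homog w" for D w
      using sj_product_commute[OF that B] sj_product_of_alg[OF z(2) that] z(1,3) by simp
    have "\<lbrace>A, lact y B\<rbrace> = A \<bullet> (y * z)" "\<lbrace>A, B\<rbrace> = A \<bullet> z"
      using sj_bracket_of_alg[OF A z(2)] sj_bracket_of_alg[OF A mult_G[OF y z(2)]]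
      by (simp_all add: z(1) lact_of_alg)
    then show ?thesis
      unfolding right[OF homog_app[OF A y]] right[OF homog_app[OF A one_G]]
        homog_app_mult[OF A y z(2)]
      by (simp add: lact_lact sign_norm)
  next
    case 5
    have ylact: "lact y B \<in> homog (v + alg_deg c)" by (rule homog_lact[OF B y])
    show ?thesis
    proof (rule first_linear_eqI)
      show "first_linear \<lbrace>A, lact y B\<rbrace>"
        by (rule sj_bracket_first_linear[OF A ylact]) (use 5 in simp)
      have "first_linear \<lbrace>A, B\<rbrace>" by (rule sj_bracket_first_linear[OF A B 5(1)])
      moreover have "first_linear (D \<odot> B)" if "D \<in> homog (u + alg_deg e - \<omega>)" for D e
        by (rule sj_product_first_linear[OF that B]) (use 5 in simp)
      ultimately show "first_linear ((A \<bullet> y) \<odot> B + deg_sign (u - \<omega>) (alg_deg c) *\<^sub>D lact y \<lbrace>A, B\<rbrace>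
          - deg_sign (u - \<omega>) (alg_deg c) *\<^sub>D lact y ((A \<bullet> 1) \<odot> B))"
        using homog_app[OF A y] homog_app[OF A one_G]
        by (intro first_linear_add first_linear_diff first_linear_scale first_linear_lact)
      fix e a assume a: "a \<in> G e"
      note Aa = homog_app[OF A a] and Ba = homog_app[OF B a]
      note Ay = homog_app[OF A y] homog_app[OF A one_G]
      note IH = less.hyps[OF _ Aa B y] less.hyps[OF _ A Ba y]
      show "\<lbrace>A, lact y B\<rbrace> \<bullet> a = ((A \<bullet> y) \<odot> B + deg_sign (u - \<omega>) (alg_deg c) *\<^sub>D lact y \<lbrace>A, B\<rbrace>
          - deg_sign (u - \<omega>) (alg_deg c) *\<^sub>D lact y ((A \<bullet> 1) \<odot> B)) \<bullet> a"
        unfolding sj_bracket_app[OF A ylact a] app_lact app_add app_diff app_scale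
          sj_bracket_app[OF A B a] sj_product_app[OF Ay(1) B a] sj_product_app[OF Ay(2) B a]
          homog_app_app[OF A y a] homog_app_app[OF A one_G a]
        using IH 5 by (simp add: sign_norm)
    qed
  qed
qed

text \<open>Antisymmetry applied to the rule for the right argument. The second coefficient combines
  exchanging the bracket with moving B(y) past A; in the last one the two signs between y and B
  cancel.\<close>

lemma sj_bracket_lact_left:
  assumes "A \<in> homog u" "B \<in> homog v" "y \<in> G c"
  shows "\<lbrace>lact y A, B\<rbrace> = lact y \<lbrace>A, B\<rbrace>
    - (deg_sign (u + alg_deg c - \<omega>) (v - \<omega>) * deg_sign (v + alg_deg c - \<omega>) u) *\<^sub>D (A \<odot> (B \<bullet> y))
    + (deg_sign u (v - \<omega>) * deg_sign (u - \<omega>) (v - \<omega>)) *\<^sub>D lact y (A \<odot> (B \<bullet> 1))"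
  unfolding sj_bracket_commute[OF homog_lact[OF assms(1,3)] assms(2)]
    sj_bracket_lact_right[OF assms(2,1,3)] sj_bracket_commute[OF assms(2,1)]
    sj_product_commute[OF homog_app[OF assms(2,3)] assms(1)]
    sj_product_commute[OF homog_app[OF assms(2) one_G] assms(1)]
  by (simp add: sign_norm)

text \<open>Expanding both halves of the bracket at ab produces cross terms such as A(a) B(b), b
  A(a) B(1) and ab A(1) B(1). They cancel between the halves, which leaves the first order
  condition.\<close>

lemma sj_bracket_mem:
  assumes "A \<in> homog u" "B \<in> homog v"
  shows "\<lbrace>A, B\<rbrace> \<in> homog (u + v - \<omega>)"
  using assms
proof (induction "nat (snd u + snd v)" arbitrary: u v A B rule: less_induct)
  case less
  note A = less.prems(1) and B = less.prems(2)
  note mem [simp] = A[THEN homog_mem_DO_all] B[THEN homog_mem_DO_all]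
  have genus_zero: "\<lbrace>A, B\<rbrace> \<in> homog (u + v - \<omega>)"
    if hom: "A \<in> homog u" "B \<in> homog v" "snd v = 0" for A B u v
  proof -
    obtain x where x: "B = of_alg x" "x \<in> G (fst v)" "v = alg_deg (fst v)"
      using hom(2,3) by (rule homog_genus_zero)
    show ?thesis
      using homog_app[OF hom(1) x(2)] sj_bracket_of_alg[OF hom(1) x(2)] x(1,3) by simp
  qed
  consider "snd u < 0" | "snd v < 0" | "snd u = 0" | "snd v = 0"
    | "snd u \<ge> 1" "snd v \<ge> 1" by linarith
  then show ?case
  proof cases
    case 1
    then show ?thesis using homog_negative[OF A] by simp
  next
    case 2
    then show ?thesis using homog_negative[OF B] by simp
  next
    case 3
    show ?thesis
      unfolding sj_bracket_commute[OF A B]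
      using genus_zero[OF B A 3] by (simp add: minus_mem_homog scale_mem_homog add.commute)
  next
    case 4
    then show ?thesis using genus_zero[OF A B] by simp
  next
    case 5
    let ?D = "\<lbrace>A, B\<rbrace>"
    have app_left: "\<lbrace>A \<bullet> a, B\<rbrace> \<in> homog (u + v - \<omega> + alg_deg e - \<omega>)" if "a \<in> G e" for a e
      using less.hyps[OF _ homog_app[OF A that] B] 5 by (simp add: algebra_simps)
    have app_right: "\<lbrace>A, B \<bullet> a\<rbrace> \<in> homog (u + v - \<omega> + alg_deg e - \<omega>)" if "a \<in> G e" for a e
      using less.hyps[OF _ A homog_app[OF B that]] 5 by (simp add: algebra_simps)
    show ?thesis
    proof (rule homogI)
      show "snd (u + v - \<omega>) \<ge> 1" using 5 by simp
      show "first_linear ?D" by (rule sj_bracket_first_linear[OF A B]) (use 5 in simp)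
      show "?D \<bullet> a \<in> homog (u + v - \<omega> + alg_deg e - \<omega>)" if "a \<in> G e" for a e
        unfolding sj_bracket_app[OF A B that]
        by (intro add_mem_homog scale_mem_homog app_left app_right that)
      fix e f a b assume a: "a \<in> G e" and b: "b \<in> G f"
      note Aa = homog_app[OF A a] homog_app[OF A b] homog_app[OF A one_G]
        and Ba = homog_app[OF B a] homog_app[OF B b] homog_app[OF B one_G]
      note ab = mult_G[OF a b]
      show "?D \<bullet> (a * b) =
          deg_sign (alg_deg f) (u + v - \<omega> + alg_deg e - \<omega>) *\<^sub>D lact b (?D \<bullet> a)
        + deg_sign (alg_deg e) (u + v - \<omega> - \<omega>) *\<^sub>D lact a (?D \<bullet> b)
        - deg_sign (alg_deg e + alg_deg f) (u + v - \<omega> - \<omega>) *\<^sub>D lact (a * b) (?D \<bullet> 1)"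
        unfolding sj_bracket_app[OF A B ab] homog_app_mult[OF A a b] homog_app_mult[OF B a b]
          sj_bracket_app[OF A B a] sj_bracket_app[OF A B b] sj_bracket_app[OF A B one_G]
        by (simp add: sj_bracket_lact_left[OF Aa(1) B b] sj_bracket_lact_left[OF Aa(2) B a]
            sj_bracket_lact_left[OF Aa(3) B ab] sj_bracket_lact_right[OF A Ba(1) b]
            sj_bracket_lact_right[OF A Ba(2) a] sj_bracket_lact_right[OF A Ba(3) ab]
            homog_app_mult[OF A a b] homog_app_mult[OF B a b]
            sj_product_lact_left[OF Aa(1) Ba(3) b] sj_product_lact_left[OF Aa(2) Ba(3) a]
            sj_product_lact_left[OF Aa(3) Ba(3) ab] sj_product_lact_right[OF Aa(3) Ba(1) b]
            sj_product_lact_right[OF Aa(3) Ba(2) a] sj_product_lact_right[OF Aa(3) Ba(3) ab]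
            sign_norm)
      show "?D \<bullet> a \<bullet> b = deg_sign (alg_deg e - \<omega>) (alg_deg f - \<omega>) *\<^sub>D (?D \<bullet> b \<bullet> a)"
        unfolding sj_bracket_app[OF A B a] sj_bracket_app[OF A B b] app_add app_scale
          sj_bracket_app[OF Aa(1) B b] sj_bracket_app[OF Aa(2) B a]
          sj_bracket_app[OF A Ba(1) b] sj_bracket_app[OF A Ba(2) a]
          homog_app_app[OF A a b] homog_app_app[OF B a b]
        by (simp add: sign_norm)
    qed
  qed
qed

lemma sj_product_mem_DO_all [simp]: "A \<in> DO_all \<Longrightarrow> B \<in> DO_all \<Longrightarrow> A \<odot> B \<in> DO_all"
  and sj_bracket_mem_DO_all [simp]: "A \<in> DO_all \<Longrightarrow> B \<in> DO_all \<Longrightarrow> \<lbrace>A, B\<rbrace> \<in> DO_all"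
proof -
  have "A \<odot> B \<in> DO_all \<and> \<lbrace>A, B\<rbrace> \<in> DO_all" if "A \<in> DO_all" "B \<in> DO_all"
    using that
  proof (induction arbitrary: B rule: DO_all_induct)
    case (homogeneous i p A)
    show ?case
      using homogeneous(2)
    proof (induction rule: DO_all_induct)
      case (homogeneous j q B)
      have "A \<in> homog (total_deg i p)" "B \<in> homog (total_deg j q)"
        using homogeneous \<open>A \<in> DO i p\<close> by simp_all
      from sj_product_mem[OF this] sj_bracket_mem[OF this] show ?case
        using homog_mem_DO_all by blast
    qed (simp add: mem_DO_all[OF homogeneous(1)])
  qed simp
  then show "A \<in> DO_all \<Longrightarrow> B \<in> DO_all \<Longrightarrow> A \<odot> B \<in> DO_all"
    and "A \<in> DO_all \<Longrightarrow> B \<in> DO_all \<Longrightarrow> \<lbrace>A, B\<rbrace> \<in> DO_all" by auto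
qed

section \<open>Graded Jacobi algebra identities\<close>

text \<open>Equivalent to associativity in the presence of \<open>sj_product_commute\<close>. This
  form is symmetric in A and B, so one argument settles both genus 0 cases, and taking A = B odd
  gives A(AC) = - A(AC) directly.\<close>

lemma sj_product_left_commute:
  assumes "A \<in> homog u" "B \<in> homog v" "C \<in> homog w"
  shows "A \<odot> (B \<odot> C) = deg_sign u v *\<^sub>D (B \<odot> (A \<odot> C))"
  using assms
proof (induction "nat (snd u + snd v + snd w)" arbitrary: u v w A B C rule: less_induct)
  case less
  note A = less.prems(1) and B = less.prems(2) and C = less.prems(3)
  note mem [simp] = A[THEN homog_mem_DO_all] B[THEN homog_mem_DO_all] C[THEN homog_mem_DO_all]
  note AC = sj_product_mem[OF A C] and BC = sj_product_mem[OF B C]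
  have genus_zero: "A \<odot> (B \<odot> C) = deg_sign u v *\<^sub>D (B \<odot> (A \<odot> C))"
    if hom: "A \<in> homog u" "B \<in> homog v" "snd u = 0" for A B u v
  proof -
    obtain x where x: "A = of_alg x" "x \<in> G (fst u)" "u = alg_deg (fst u)"
      using hom(1,3) by (rule homog_genus_zero)
    have "of_alg x \<odot> (B \<odot> C) = lact x (B \<odot> C)" "of_alg x \<odot> C = lact x C"
      using sj_product_of_alg[OF x(2)] sj_product_mem[OF hom(2) C] C by blast+
    then show ?thesis
      using sj_product_lact_right[OF hom(2) C x(2)] x(1,3)
      by (simp add: deg_sign_commute[of u])
  qed
  consider "snd u < 0 \<or> snd v < 0 \<or> snd w < 0" | "snd u = 0" | "snd v = 0"
    | "snd u \<ge> 1" "snd v \<ge> 1" "snd w \<ge> 0" by linarith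
  then show ?case
  proof cases
    case 1
    then show ?thesis using homog_negative[OF A] homog_negative[OF B] homog_negative[OF C] by auto
  next
    case 2
    then show ?thesis by (rule genus_zero[OF A B])
  next
    case 3
    from genus_zero[OF B A 3] show ?thesis by (simp add: deg_sign_commute[of u])
  next
    case 4
    show ?thesis
    proof (rule homog_eqI)
      show "A \<odot> (B \<odot> C) \<in> homog (u + (v + w))" by (rule sj_product_mem[OF A BC])
      have "B \<odot> (A \<odot> C) \<in> homog (u + (v + w))"
        using sj_product_mem[OF B AC] by (simp add: add_ac)
      then show "deg_sign u v *\<^sub>D (B \<odot> (A \<odot> C)) \<in> homog (u + (v + w))"
        by (rule scale_mem_homog)
      show "snd (u + (v + w)) \<ge> 1" using 4 by simp
      fix e a assume a: "a \<in> G e"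
      note Aa = homog_app[OF A a] and Ba = homog_app[OF B a] and Ca = homog_app[OF C a]
      note IH = less.hyps[OF _ Aa B C] less.hyps[OF _ A Ba C] less.hyps[OF _ A B Ca]
      show "(A \<odot> (B \<odot> C)) \<bullet> a = (deg_sign u v *\<^sub>D (B \<odot> (A \<odot> C))) \<bullet> a"
        unfolding app_scale sj_product_app[OF A BC a] sj_product_app[OF B AC a]
          sj_product_app[OF A C a] sj_product_app[OF B C a]
        using IH 4 by (simp add: sign_norm)
    qed
  qed
qed

text \<open>The correction is forced by B = C = 1, where both first terms equal A(1). For A in the
  algebra the rule is \<open>sj_product_app\<close>, for B it is
  \<open>sj_bracket_lact_right\<close>; once both have positive genus so do the two sides, even with
  C in the algebra.\<close>

lemma sj_bracket_Leibniz:
  assumes "A \<in> homog u" "B \<in> homog v" "C \<in> homog w"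
  shows "\<lbrace>A, B \<odot> C\<rbrace> = \<lbrace>A, B\<rbrace> \<odot> C + deg_sign (u - \<omega>) v *\<^sub>D (B \<odot> \<lbrace>A, C\<rbrace>) - (A \<bullet> 1) \<odot> (B \<odot> C)"
  using assms
proof (induction "nat (snd u + snd v + snd w)" arbitrary: u v w A B C rule: less_induct)
  case less
  note A = less.prems(1) and B = less.prems(2) and C = less.prems(3)
  note mem [simp] = A[THEN homog_mem_DO_all] B[THEN homog_mem_DO_all] C[THEN homog_mem_DO_all]
  note AB = sj_bracket_mem[OF A B] and AC = sj_bracket_mem[OF A C] and BC = sj_product_mem[OF B C]
    and A1 = homog_app[OF A one_G]
  consider "snd u < 0 \<or> snd v < 0 \<or> snd w < 0" | "snd u = 0" | "snd v = 0"
    | "snd u \<ge> 1" "snd v \<ge> 1" "snd w \<ge> 0" by linarith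
  then show ?case
  proof cases
    case 1
    then show ?thesis using homog_negative[OF A] homog_negative[OF B] homog_negative[OF C] by auto
  next
    case 2
    from A 2 obtain x where x: "A = of_alg x" "x \<in> G (fst u)" "u = alg_deg (fst u)"
      by (rule homog_genus_zero)
    have bracket: "\<lbrace>A, D\<rbrace> = - (deg_sign (u - \<omega>) (t - \<omega>) *\<^sub>D (D \<bullet> x))" if "D \<in> homog t" for D t
      using sj_bracket_commute[OF A that] sj_bracket_of_alg[OF that x(2)] x(1) by simp
    have "A \<bullet> 1 = 0" using x(1) by simp
    then show ?thesis
      unfolding bracket[OF B] bracket[OF C] bracket[OF BC] sj_product_app[OF B C x(2)] x(3)[symmetric]
      by (simp add: sign_norm)
  next
    case 3
    from B 3 obtain y where y: "B = of_alg y" "y \<in> G (fst v)" "v = alg_deg (fst v)"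
      by (rule homog_genus_zero)
    have "B \<odot> C = lact y C" "B \<odot> \<lbrace>A, C\<rbrace> = lact y \<lbrace>A, C\<rbrace>" "\<lbrace>A, B\<rbrace> = A \<bullet> y"
      using sj_product_of_alg[OF y(2) C] sj_product_of_alg[OF y(2) AC] sj_bracket_of_alg[OF A y(2)] y(1)
      by simp_all
    then show ?thesis
      using sj_bracket_lact_right[OF A C y(2)] sj_product_lact_right[OF A1 C y(2)]
      by (simp add: y(3)[symmetric])
  next
    case 4
    let ?t = "u + v + w - \<omega>"
    show ?thesis
    proof (rule homog_eqI)
      show "\<lbrace>A, B \<odot> C\<rbrace> \<in> homog ?t"
        using sj_bracket_mem[OF A BC] by (simp add: algebra_simps)
      have "\<lbrace>A, B\<rbrace> \<odot> C \<in> homog ?t" "B \<odot> \<lbrace>A, C\<rbrace> \<in> homog ?t" "(A \<bullet> 1) \<odot> (B \<odot> C) \<in> homog ?t"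
        using sj_product_mem[OF AB C] sj_product_mem[OF B AC] sj_product_mem[OF A1 BC]
        by (simp_all add: algebra_simps)
      then show "\<lbrace>A, B\<rbrace> \<odot> C + deg_sign (u - \<omega>) v *\<^sub>D (B \<odot> \<lbrace>A, C\<rbrace>) - (A \<bullet> 1) \<odot> (B \<odot> C) \<in> homog ?t"
        using add_mem_homog minus_mem_homog scale_mem_homog by (metis diff_conv_add_uminus)
      show "snd ?t \<ge> 1" using 4 by simp
      fix e a assume a: "a \<in> G e"
      note Aa = homog_app[OF A a] and Ba = homog_app[OF B a] and Ca = homog_app[OF C a]
      note IH = less.hyps[OF _ Aa B C] less.hyps[OF _ A Ba C] less.hyps[OF _ A B Ca]
      show "\<lbrace>A, B \<odot> C\<rbrace> \<bullet> a
        = (\<lbrace>A, B\<rbrace> \<odot> C + deg_sign (u - \<omega>) v *\<^sub>D (B \<odot> \<lbrace>A, C\<rbrace>) - (A \<bullet> 1) \<odot> (B \<odot> C)) \<bullet> a"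
        unfolding app_scale app_add app_diff sj_bracket_app[OF A BC a] sj_product_app[OF AB C a]
          sj_product_app[OF B AC a] sj_product_app[OF A1 BC a] sj_product_app[OF B C a]
          sj_bracket_app[OF A B a] sj_bracket_app[OF A C a] homog_app_app[OF A one_G a]
        using IH 4 by (simp add: sign_norm)
    qed
  qed
qed

text \<open>Written as a derivation rule for the right operator given by C, so that for C in the
  algebra it is \<open>sj_bracket_app\<close>.\<close>

lemma sj_bracket_Jacobi:
  assumes "A \<in> homog u" "B \<in> homog v" "C \<in> homog w"
  shows "\<lbrace>\<lbrace>A, B\<rbrace>, C\<rbrace> = deg_sign (v - \<omega>) (w - \<omega>) *\<^sub>D \<lbrace>\<lbrace>A, C\<rbrace>, B\<rbrace> + \<lbrace>A, \<lbrace>B, C\<rbrace>\<rbrace>"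
  using assms
proof (induction "nat (snd u + snd v + snd w)" arbitrary: u v w A B C rule: less_induct)
  case less
  note A = less.prems(1) and B = less.prems(2) and C = less.prems(3)
  note mem [simp] = A[THEN homog_mem_DO_all] B[THEN homog_mem_DO_all] C[THEN homog_mem_DO_all]
  note AB = sj_bracket_mem[OF A B] and AC = sj_bracket_mem[OF A C] and BC = sj_bracket_mem[OF B C]
  have left: "\<lbrace>D, E\<rbrace> = - (deg_sign (r - \<omega>) (t - \<omega>) *\<^sub>D (E \<bullet> x))"
    if "D = of_alg x" "x \<in> G e" "r = alg_deg e" "E \<in> homog t" for D E x e r t
    using sj_bracket_commute[OF of_alg_mem_homog[OF that(2)] that(4)]
      sj_bracket_of_alg[OF that(4,2)] that(1,3) by simp
  consider "snd u < 0 \<or> snd v < 0 \<or> snd w < 0" | "snd u = 0" | "snd v = 0" | "snd w = 0"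
    | "snd u \<ge> 1" "snd v \<ge> 1" "snd w \<ge> 1" by linarith
  then show ?case
  proof cases
    case 1
    then show ?thesis using homog_negative[OF A] homog_negative[OF B] homog_negative[OF C] by auto
  next
    case 2
    from A 2 obtain x where x: "A = of_alg x" "x \<in> G (fst u)" "u = alg_deg (fst u)"
      by (rule homog_genus_zero)
    \<comment> \<open>Brackets with x become evaluations at x, and the claim is the derivation rule
      for [[B, C]] after exchanging C(x) and B in one term.\<close>
    show ?thesis
      unfolding left[OF x B] left[OF x C] left[OF x BC] sj_bracket_app[OF B C x(2)] x(3)[symmetric]
      using sj_bracket_commute[OF homog_app[OF C x(2)] B]
      by (simp add: sign_norm x(3)[symmetric])
  next
    case 3
    from B 3 obtain y where y: "B = of_alg y" "y \<in> G (fst v)" "v = alg_deg (fst v)"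
      by (rule homog_genus_zero)
    have "\<lbrace>A, B\<rbrace> = A \<bullet> y" "\<lbrace>\<lbrace>A, C\<rbrace>, B\<rbrace> = \<lbrace>A, C\<rbrace> \<bullet> y"
      using sj_bracket_of_alg[OF A y(2)] sj_bracket_of_alg[OF AC y(2)] y(1) by simp_all
    then show ?thesis
      unfolding left[OF y C] sj_bracket_app[OF A C y(2)] y(3)[symmetric]
      by (simp add: sj_bracket_app[OF A C y(2)] sign_norm y(3)[symmetric])
  next
    case 4
    from C 4 obtain z where z: "C = of_alg z" "z \<in> G (fst w)" "w = alg_deg (fst w)"
      by (rule homog_genus_zero)
    have "\<lbrace>D, C\<rbrace> = D \<bullet> z" if "D \<in> homog t" for D t
      using sj_bracket_of_alg[OF that z(2)] z(1) by simp
    note this[OF AB] this[OF A] this[OF B]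
    then show ?thesis
      using sj_bracket_app[OF A B z(2)] by (simp add: z(3)[symmetric] deg_sign_commute)
  next
    case 5
    let ?t = "u + v + w - \<omega> - \<omega>"
    show ?thesis
    proof (rule homog_eqI)
      show "\<lbrace>\<lbrace>A, B\<rbrace>, C\<rbrace> \<in> homog ?t"
        using sj_bracket_mem[OF AB C] by (simp add: algebra_simps)
      have "\<lbrace>\<lbrace>A, C\<rbrace>, B\<rbrace> \<in> homog ?t" "\<lbrace>A, \<lbrace>B, C\<rbrace>\<rbrace> \<in> homog ?t"
        using sj_bracket_mem[OF AC B] sj_bracket_mem[OF A BC] by (simp_all add: algebra_simps)
      then show "deg_sign (v - \<omega>) (w - \<omega>) *\<^sub>D \<lbrace>\<lbrace>A, C\<rbrace>, B\<rbrace> + \<lbrace>A, \<lbrace>B, C\<rbrace>\<rbrace> \<in> homog ?t"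
        by (intro add_mem_homog scale_mem_homog)
      show "snd ?t \<ge> 1" using 5 by simp
      fix e a assume a: "a \<in> G e"
      note Aa = homog_app[OF A a] and Ba = homog_app[OF B a] and Ca = homog_app[OF C a]
      note IH = less.hyps[OF _ Aa B C] less.hyps[OF _ A Ba C] less.hyps[OF _ A B Ca]
      show "\<lbrace>\<lbrace>A, B\<rbrace>, C\<rbrace> \<bullet> a
          = (deg_sign (v - \<omega>) (w - \<omega>) *\<^sub>D \<lbrace>\<lbrace>A, C\<rbrace>, B\<rbrace> + \<lbrace>A, \<lbrace>B, C\<rbrace>\<rbrace>) \<bullet> a"
        unfolding app_scale app_add sj_bracket_app[OF AB C a] sj_bracket_app[OF AC B a]
          sj_bracket_app[OF A BC a] sj_bracket_app[OF A B a] sj_bracket_app[OF A C a]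
          sj_bracket_app[OF B C a]
        using IH 5 by (simp add: sign_norm)
    qed
  qed
qed

end

section \<open>The Lichnerowicz-Jacobi operator\<close>

context schouten_jacobi
begin

text \<open>The squares of [[S, .]] and of multiplication by S(1) come out equal to their own
  negatives; characteristic 0 turns this into vanishing.\<close>

lemma add_self_eq_zero: "D + D = 0 \<Longrightarrow> D = (0 :: 'a list \<Rightarrow> 'a)"
proof -
  assume "D + D = 0"
  then have "(1 + 1) *\<^sub>D D = 0" by (simp only: fun_space.scale_left_distrib fun_space.scale_one)
  then show "D = 0" by (simp add: fun_space.scale_eq_0_iff)
qed

context
  fixes S :: "'a list \<Rightarrow> 'a" and w :: "(int ^ 'n) \<times> int"
  assumes S: "S \<in> homog w"
    and odd: "deg_sign (w - \<omega>) (w - \<omega>) = - 1"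
    and SS: "\<lbrace>S, S\<rbrace> = 0"
begin

lemma S_mem [simp]: "S \<in> DO_all"
  by (rule homog_mem_DO_all[OF S])

text \<open>The product bidegree of S(1) is the bracket bidegree of S, so the single assumption
  \<open>odd\<close> serves both the bracket with S and the product with S(1).\<close>

lemma S1_mem: "S \<bullet> 1 \<in> homog (w - \<omega>)"
  using homog_app[OF S one_G] by simp

lemma bracket_bracket_eq_zero:
  assumes "A \<in> homog v"
  shows "\<lbrace>S, \<lbrace>S, A\<rbrace>\<rbrace> = 0"
proof (rule add_self_eq_zero)
  let ?X = "\<lbrace>S, \<lbrace>S, A\<rbrace>\<rbrace>"
  note A [simp] = homog_mem_DO_all[OF assms]
  \<comment> \<open>The dependence on A cancels: what remains is the sign of S with itself, so the
    two terms of the Jacobi identity add up instead of cancelling.\<close>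
  have "deg_sign (w - \<omega>) (v - \<omega>) * deg_sign (w + v - \<omega> - \<omega>) (w - \<omega>)
      = deg_sign (w - \<omega>) (w - \<omega>)"
    by (simp add: deg_sign_simps deg_sign_commute mult_ac)
  then have sgn: "deg_sign (w - \<omega>) (v - \<omega>) * deg_sign (w + v - \<omega> - \<omega>) (w - \<omega>) = - 1"
    by (simp only: odd)
  have "0 = deg_sign (w - \<omega>) (v - \<omega>) *\<^sub>D \<lbrace>\<lbrace>S, A\<rbrace>, S\<rbrace> + ?X"
    using sj_bracket_Jacobi[OF S S assms] by (simp add: SS)
  also have "\<lbrace>\<lbrace>S, A\<rbrace>, S\<rbrace> = - (deg_sign (w + v - \<omega> - \<omega>) (w - \<omega>) *\<^sub>D ?X)"
    by (rule sj_bracket_commute[OF sj_bracket_mem[OF S assms] S])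
  also have "deg_sign (w - \<omega>) (v - \<omega>) *\<^sub>D - (deg_sign (w + v - \<omega> - \<omega>) (w - \<omega>) *\<^sub>D ?X) = ?X"
    unfolding fun_space.scale_minus_right fun_space.scale_scale sgn by simp
  finally show "?X + ?X = 0" by simp
qed

lemma bracket_S1_eq_zero: "\<lbrace>S, S \<bullet> 1\<rbrace> = 0"
  using bracket_bracket_eq_zero[OF of_alg_mem_homog[OF one_G]] sj_bracket_of_alg[OF S one_G]
  by simp

lemma S1_S1_eq_zero:
  assumes "A \<in> homog v"
  shows "(S \<bullet> 1) \<odot> ((S \<bullet> 1) \<odot> A) = 0"
proof (rule add_self_eq_zero)
  have "(S \<bullet> 1) \<odot> ((S \<bullet> 1) \<odot> A) = - ((S \<bullet> 1) \<odot> ((S \<bullet> 1) \<odot> A))"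
    using sj_product_left_commute[OF S1_mem S1_mem assms] by (simp add: odd)
  then show "(S \<bullet> 1) \<odot> ((S \<bullet> 1) \<odot> A) + (S \<bullet> 1) \<odot> ((S \<bullet> 1) \<odot> A) = 0"
    by (simp only: eq_neg_iff_add_eq_0)
qed

text \<open>Two of the three Leibniz terms vanish, [[S, T]] A and the correction T(TA) with T =
  S(1); the minus sign is \<open>odd\<close>.\<close>

lemma bracket_S1_product:
  assumes "A \<in> homog v"
  shows "\<lbrace>S, (S \<bullet> 1) \<odot> A\<rbrace> = - ((S \<bullet> 1) \<odot> \<lbrace>S, A\<rbrace>)"
  using sj_bracket_Leibniz[OF S S1_mem assms]
  by (simp add: odd bracket_S1_eq_zero S1_S1_eq_zero[OF assms] homog_mem_DO_all[OF assms])

text \<open>With T = S(1) the square is [[S, [[S, A]]]] + t ([[S, TA]] + T [[S, A]]) + t^2 T(TA),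
  and each coefficient of a power of t vanishes.\<close>

lemma LJ_operator_square_homogeneous:
  assumes "A \<in> homog v"
  shows "LJ_operator t S (LJ_operator t S A) = 0"
  using bracket_bracket_eq_zero[OF assms] S1_S1_eq_zero[OF assms] bracket_S1_product[OF assms]
    homog_mem_DO_all[OF assms]
  by (simp add: LJ_operator_def)

lemma LJ_operator_mem: "A \<in> DO_all \<Longrightarrow> LJ_operator t S A \<in> DO_all"
  and LJ_operator_add: "A \<in> DO_all \<Longrightarrow> B \<in> DO_all \<Longrightarrow>
    LJ_operator t S (A + B) = LJ_operator t S A + LJ_operator t S B"
  and LJ_operator_scale: "A \<in> DO_all \<Longrightarrow>
    LJ_operator t S (c *\<^sub>D A) = c *\<^sub>D LJ_operator t S A"
  by (simp_all add: LJ_operator_def fun_scale_simps add_ac mult.commute)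

lemma LJ_operator_square: "A \<in> DO_all \<Longrightarrow> LJ_operator t S (LJ_operator t S A) = 0"
proof (induction rule: DO_all_induct)
  case (homogeneous i p A)
  then show ?case using LJ_operator_square_homogeneous[of A "total_deg i p"] by simp
qed (simp add: LJ_operator_mem LJ_operator_add)

lemma cohomology_operator_LJ: "cohomology_operator_on DO_all scale_fun (LJ_operator t S)"
  unfolding cohomology_operator_on_def
  by (simp add: LJ_operator_mem LJ_operator_add LJ_operator_scale LJ_operator_square)

lemma LJ_operator_mem_homog:
  assumes "A \<in> homog v"
  shows "LJ_operator t S A \<in> homog (v + w - \<omega>)"
  unfolding LJ_operator_def
  using sj_bracket_mem[OF S assms] sj_product_mem[OF S1_mem assms]
  by (intro add_mem_homog scale_mem_homog) (simp_all add: algebra_simps)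

end

end

theorem mainTheorem7:
  fixes scale :: "'k::field_char_0 \<Rightarrow> 'a::{ring, monoid_mult} \<Rightarrow> 'a"
    and G :: "int ^ 'n \<Rightarrow> 'a set"
    and \<alpha> :: "int ^ 'n"
    and S :: "'a list \<Rightarrow> 'a"
    and t :: 'k
  assumes "graded_comm_algebra scale G"
    and "schouten_jacobi.supercanonical scale G \<alpha> \<alpha> S"
  shows "cohomology_operator_on (schouten_jacobi.DO_all scale G \<alpha>)
           (schouten_jacobi.scale_fun scale) (schouten_jacobi.LJ_operator scale G \<alpha> t S)
       \<and> (\<forall>i d. \<forall>A \<in> schouten_jacobi.DO scale G \<alpha> i d.
            schouten_jacobi.LJ_operator scale G \<alpha> t S A
              \<in> schouten_jacobi.DO scale G \<alpha> (Suc i) (d + \<alpha>))"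
proof -
  interpret schouten_jacobi scale G \<alpha>
    using assms(1) by (simp add: schouten_jacobi_def)
  let ?w = "total_deg 2 \<alpha>"
  have S: "S \<in> homog ?w" and SS: "sj_bracket S S = 0"
    using assms(2) by (simp_all add: supercanonical_def)
  \<comment> \<open>Genus 2 is unfolded into two shifts by \<omega>, and
    \<open>total_deg 0 0\<close> is zero. The operator therefore shifts bidegrees by
    \<open>alg_deg \<alpha> + \<omega>\<close>: degree \<alpha> and one genus.\<close>
  have w: "?w = alg_deg \<alpha> + total_deg 0 0 + \<omega> + \<omega>"
    using total_deg_Suc[of 0 \<alpha>] total_deg_Suc[of 1 \<alpha>] total_deg_add[of 0 0 \<alpha>]
    by (simp add: numeral_2_eq_2 add_ac)
  \<comment> \<open>(3 \<alpha>, 2) - (\<alpha>, 1): the first entry is even, so the parity of the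
    self-pairing is decided by the genus entry 1.\<close>
  have "?w - \<omega> = (\<alpha> + \<alpha>, 1)"
    by (simp add: total_deg_def \<omega>_def prod_eq_iff vec_eq_iff)
  then have odd: "deg_sign (?w - \<omega>) (?w - \<omega>) = - 1"
    by (simp only: deg_sign_def fst_conv snd_conv pairing_add_left) simp
  have "LJ_operator t S A \<in> DO (Suc i) (d + \<alpha>)" if "A \<in> DO i d" for i d A
  proof -
    have "total_deg i d + ?w - \<omega> = total_deg (Suc i) (d + \<alpha>)"
      by (simp add: w total_deg_Suc total_deg_add total_deg_zero)
    then show ?thesis
      using LJ_operator_mem_homog[OF S odd SS, of A "total_deg i d" t] that by simp
  qed
  then show ?thesis
    using cohomology_operator_LJ[OF S odd SS] by blast
qed

end
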